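(* For complex $\mathbf{s}=(s_1,\dots,s_6)$ let \[\zeta(\mathbf{s};G_2)=\sum_{m,n>0}\frac{1}{m^{s_1}n^{s_2}(m+n)^{s_3}(m+2n)^{s_4}(m+3n)^{s_5}(2m+3n)^{s_6}}.\] For any integers $k_1,\dots,k_6\ge1$ with $k=k_1+\cdots+k_6$ odd, the value $\zeta(k_1,\dots,k_6;G_2)$ can be expressed as a $\mathbb{Q}$-linear combination of the numbers $\zeta(2n)\zeta(k-2n)$ $(0\le n\le \frac{k-3}{2})$ and $L(2n+1,\chi_3)L(k-2n-1,\chi_3)$ $(0\le n\le\frac{k-3}{2})$, where $\zeta(0)=-\tfrac12$.
   Context: $\zeta(s)$ is the Riemann zeta function. $\chi_3$ is the Dirichlet character modulo $3$ with $\chi_3(n)=1$ if $n\equiv1\pmod 3$, $\chi_3(n)=-1$ if $n\equiv2\pmod 3$, $\chi_3(n)=0$ if $3\mid n$, and $L(s,\chi_3)=\sum_{m>0}\chi_3(m)m^{-s}$ (so $L(1,\chi_3)$ is the conditionally convergent value $\frac{\pi}{3\sqrt3}$). The series $\zeta(\mathbf{k};G_2)$ converges absolutely for $\mathbf{k}\in\mathbb{Z}_{>0}^6$. *)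

theory Defs
  imports "HOL-Analysis.Analysis"
begin

text \<open>
  The summation is unordered and runs over pairs of positive integers. It is meant to be used where
  the series converges absolutely, in particular whenever all six arguments are positive integers
  (elsewhere \<^const>\<open>infsum\<close> returns 0). The bases are positive reals, so the
  principal branch of \<open>powr\<close> is the usual power.
\<close>
definition zeta_G2 ::
  "complex \<Rightarrow> complex \<Rightarrow> complex \<Rightarrow> complex \<Rightarrow> complex \<Rightarrow> complex \<Rightarrow> complex" where
  "zeta_G2 s1 s2 s3 s4 s5 s6 =
     (\<Sum>\<^sub>\<infinity>(m, n) \<in> {0<..} \<times> {0<..}.
        1 / (of_nat m powr s1 * of_nat n powr s2 * of_nat (m + n) powr s3 *
             of_nat (m + 2 * n) powr s4 * of_nat (m + 3 * n) powr s5 *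
             of_nat (2 * m + 3 * n) powr s6))"

text \<open>
  The Riemann zeta function on the half-plane \<open>Re s > 1\<close>, together with its value
  \<open>-1/2\<close> at 0, which the Dirichlet series does not give. It does not represent the analytic
  continuation at other arguments.
\<close>
definition zeta :: "complex \<Rightarrow> complex" where
  "zeta s = (if s = 0 then - 1 / 2 else (\<Sum>m. 1 / of_nat (Suc m) powr s))"

definition chi3 :: "nat \<Rightarrow> complex" where
  "chi3 n = (if n mod 3 = 1 then 1 else if n mod 3 = 2 then - 1 else 0)"

text \<open>
  An ordered sum: the series is only conditionally convergent for \<open>0 < Re s \<le> 1\<close>,
  in particular at \<open>s = 1\<close>.
\<close>
definition L_chi3 :: "complex \<Rightarrow> complex" where
  "L_chi3 s = (\<Sum>m. chi3 (Suc m) / of_nat (Suc m) powr s)"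

end

theory Submission
  imports Defs
begin

text \<open>
  Let \<open>f(m, n)\<close> be the summand, extended to all integers with \<open>1 / 0 = 0\<close>, so that
  it vanishes on the lines where one of the six linear forms does. Since \<open>k\<close> is odd,
  \<open>f(-m, -n) = -f(m, n)\<close>, and therefore the quadrants \<open>m > 0 > n\<close> and
  \<open>m < 0 < n\<close> cancel: the sum of \<open>f\<close> over \<open>m, n > 0\<close> is half the total of its
  sums over the half-planes \<open>m > 0\<close> and \<open>n > 0\<close>.

  On a half-plane, fix the variable of constant sign, say \<open>m\<close>, and decompose \<open>f(m, n)\<close> into
  partial fractions in \<open>n\<close>. The terms are rational multiples of
  \<open>1 / (m\<^sup>k\<^sup>-\<^sup>j (a n + b m)\<^sup>j)\<close> with \<open>a \<in> {1, 2, 3}\<close>. Summed over \<open>n\<close>,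
  symmetrically because of \<open>j = 1\<close>, they give \<open>\<zeta>(j)\<close> for even \<open>j\<close>, with a rational
  coefficient depending on \<open>m\<close> modulo \<open>a\<close>, and a multiple of
  \<open>\<chi>\<^sub>3(m) L(j, \<chi>\<^sub>3)\<close> for odd \<open>j\<close>. Summing over \<open>m\<close> then yields
  \<open>\<zeta>(j) \<zeta>(k - j)\<close> or \<open>L(j, \<chi>\<^sub>3) L(k - j, \<chi>\<^sub>3)\<close>. The points at which a form
  vanishes contribute a rational multiple of \<open>\<zeta>(k) = -2 \<zeta>(0) \<zeta>(k)\<close>.
\<close>

subsection \<open>Real zeta and L values\<close>

text \<open>Defined on all integers because the residues it is applied to may have either sign. Real
  values suffice: the whole argument runs over the reals and passes to the complex numbers only at
  the end.\<close>

definition chi :: "int \<Rightarrow> real" where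
  "chi r = (if r mod 3 = 1 then 1 else if r mod 3 = 2 then - 1 else 0)"

text \<open>The series diverges at \<open>j = 1\<close>, so the value there is meaningless.\<close>

definition zeta_real :: "nat \<Rightarrow> real" where
  "zeta_real j = (if j = 0 then - 1 / 2 else (\<Sum>n. 1 / real (Suc n) ^ j))"

definition L_real :: "nat \<Rightarrow> real" where
  "L_real j = (\<Sum>n. chi (int (Suc n)) / real (Suc n) ^ j)"

lemma chi_mult: "chi (a * b) = chi a * chi b"
proof -
  have ab: "a mod 3 \<in> {0, 1, 2}" "b mod 3 \<in> {0, 1, 2}"
    by auto
  have eq: "(a * b) mod 3 = (a mod 3) * (b mod 3) mod 3"
    by (simp add: mod_mult_eq)
  show ?thesis
    unfolding chi_def eq using ab by (elim insertE emptyE; simp)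
qed

lemma zeta_real_sums:
  assumes "j \<ge> 2"
  shows "(\<lambda>n. 1 / real (Suc n) ^ j) sums zeta_real j"
proof -
  have "summable (\<lambda>n. inverse (real n ^ j))"
    using assms by (rule inverse_power_summable)
  then have "summable (\<lambda>n. 1 / real (Suc n) ^ j)"
    by (subst (asm) summable_Suc_iff [symmetric]) (simp add: divide_inverse)
  then show ?thesis
    using assms by (simp add: zeta_real_def summable_sums)
qed

text \<open>At \<open>j = 1\<close> the series is not absolutely convergent, so the partial sums are
  computed: up to a vanishing remainder they are partial sums of a nonnegative, bounded
  series.\<close>

lemma L_real_sums:
  assumes "j \<ge> 1"
  shows "(\<lambda>n. chi (int (Suc n)) / real (Suc n) ^ j) sums L_real j"
proof -
  \<comment> \<open>pairing the terms \<open>3n + 1\<close> and \<open>3n + 2\<close> makes the series nonnegative\<close>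
  define h where "h n = 1 / real (3 * n + 1) ^ j - 1 / real (3 * n + 2) ^ j" for n
  \<comment> \<open>Among the integers from 1 to \<open>M\<close> there are
    \<open>Suc M div 3\<close> complete pairs; if \<open>M mod 3 = 1\<close>, the last term has no
    partner, and \<open>e M\<close> is that term.\<close>
  define e where
    "e M = (if M mod 3 = 1 then 1 / real M ^ j else 0)" for M
  have h_nonneg: "h n \<ge> 0" for n
    unfolding h_def by (simp add: frac_le power_mono)
  \<comment> \<open>The subtracted term makes the induction work: adding \<open>h N\<close> replaces
    \<open>1 / (3 * N + 1) ^ j\<close> by \<open>1 / (3 * N + 2) ^ j\<close>, which exceeds the next
    subtracted term.\<close>
  have telescope: "sum h {..<N} \<le> 1 - 1 / real (3 * N + 1) ^ j" for N
  proof (induction N)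
    case (Suc N)
    have "1 / real (3 * Suc N + 1) ^ j \<le> 1 / real (3 * N + 2) ^ j"
      by (intro divide_left_mono power_mono) auto
    with Suc show ?case
      by (simp add: h_def)
  qed simp
  have "summable h"
  proof (rule summableI_nonneg_bounded [OF h_nonneg])
    show "sum h {..<N} \<le> 1" for N
      by (rule order_trans [OF telescope]) simp
  qed
  then have "(\<lambda>N. sum h {..<N}) \<longlonglongrightarrow> suminf h"
    by (rule summable_LIMSEQ)
  moreover have "filterlim (\<lambda>M::nat. Suc M div 3) sequentially sequentially"
    unfolding filterlim_at_top
  proof
    show "\<forall>\<^sub>F x in sequentially. Z \<le> Suc x div 3" for Z :: nat
      by (rule eventually_sequentiallyI [of "3 * Z"]) auto
  qed
  ultimately have "(\<lambda>M. sum h {..<Suc M div 3}) \<longlonglongrightarrow> suminf h"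
    by (rule filterlim_compose)
  moreover have "e \<longlonglongrightarrow> 0"
  proof (rule Lim_null_comparison)
    show "\<forall>\<^sub>F M in sequentially. norm (e M) \<le> 1 / real M"
    proof (rule eventually_sequentiallyI [of 1])
      fix M :: nat
      assume "1 \<le> M"
      then have "real M ^ 1 \<le> real M ^ j"
        using assms by (intro power_increasing) auto
      then show "norm (e M) \<le> 1 / real M"
        using \<open>1 \<le> M\<close> by (auto simp: e_def intro!: divide_left_mono)
    qed
    show "(\<lambda>M. 1 / real M) \<longlonglongrightarrow> 0"
      by (rule lim_1_over_n)
  qed
  ultimately have "(\<lambda>M. sum h {..<Suc M div 3} + e M) \<longlonglongrightarrow> suminf h + 0"
    by (rule tendsto_add)
  moreover have "(\<Sum>n<M. chi (int (Suc n)) / real (Suc n) ^ j) = sum h {..<Suc M div 3} + e M" for M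
  proof (induction M)
    case (Suc M)
    have "M = 3 * (M div 3) \<or> M = 3 * (M div 3) + 1 \<or> M = 3 * (M div 3) + 2"
      by presburger
    then consider q where "M = 3 * q" | q where "M = 3 * q + 1" | q where "M = 3 * q + 2"
      by blast
    then show ?case
    proof cases
      case 1
      then have "int (Suc M) mod 3 = 1" "Suc (Suc M) div 3 = q" "Suc M div 3 = q"
        "Suc M mod 3 = 1" "M mod 3 = 0"
        by presburger+
      then show ?thesis
        using Suc.IH by (simp add: chi_def e_def)
    next
      case 2
      then have "int (Suc M) mod 3 = 2" "Suc (Suc M) div 3 = Suc q" "Suc M div 3 = q"
        "Suc M mod 3 = 2" "M mod 3 = 1"
        by presburger+
      then show ?thesis
        using Suc.IH 2 by (simp add: chi_def e_def h_def algebra_simps)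
    next
      case 3
      then have "int (Suc M) mod 3 = 0" "Suc (Suc M) div 3 = Suc q" "Suc M div 3 = Suc q"
        "Suc M mod 3 = 0" "M mod 3 = 2"
        by presburger+
      then show ?thesis
        using Suc.IH by (simp add: chi_def e_def)
    qed
  qed (simp add: e_def)
  ultimately have "(\<lambda>n. chi (int (Suc n)) / real (Suc n) ^ j) sums suminf h"
    by (simp add: sums_def)
  then show ?thesis
    by (simp add: L_real_def sums_iff)
qed

subsection \<open>Principal values over arithmetic progressions\<close>

text \<open>Symmetric partial sums are used because \<open>1 / (a * n + r) ^ j\<close> is not
  summable for \<open>j = 1\<close>. They allow a partial fraction decomposition to be summed term
  by term even though only the whole is absolutely summable.\<close>

definition has_pv :: "(int \<Rightarrow> real) \<Rightarrow> real \<Rightarrow> bool"  (infix \<open>has'_pv\<close> 46) where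
  "f has_pv L \<longleftrightarrow> (\<lambda>N. \<Sum>n\<in>{- int N..int N}. f n) \<longlonglongrightarrow> L"

lemma has_pv_unique: "f has_pv L \<Longrightarrow> f has_pv M \<Longrightarrow> L = M"
  unfolding has_pv_def by (rule LIMSEQ_unique)

lemma has_pv_diff: "f has_pv L \<Longrightarrow> g has_pv M \<Longrightarrow> (\<lambda>n. f n - g n) has_pv (L - M)"
  unfolding has_pv_def by (simp add: sum_subtractf tendsto_diff)

lemma has_pv_cmult: "f has_pv L \<Longrightarrow> (\<lambda>n. c * f n) has_pv (c * L)"
  unfolding has_pv_def by (simp add: sum_distrib_left [symmetric] tendsto_mult_left)

lemma has_pv_sum:
  assumes "\<And>i. i \<in> I \<Longrightarrow> f i has_pv L i"
  shows "(\<lambda>n. \<Sum>i\<in>I. f i n) has_pv (\<Sum>i\<in>I. L i)"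
  using assms unfolding has_pv_def by (subst sum.swap) (intro tendsto_sum)

text \<open>Every finite set of integers lies in some symmetric interval, so these intervals are
  cofinal among the finite sets. Hence an unordered sum may be computed as a principal
  value.\<close>

lemma has_sum_imp_has_pv:
  assumes "(f has_sum L) UNIV"
  shows "f has_pv L"
proof -
  have "filterlim (\<lambda>N. {- int N..int N}) (finite_subsets_at_top UNIV) sequentially"
    unfolding filterlim_finite_subsets_at_top
  proof safe
    fix X :: "int set"
    assume "finite X"
    then obtain M where "\<forall>x\<in>X. nat \<bar>x\<bar> \<le> M"
      by (metis finite_nat_set_iff_bounded_le finite_imageI imageI)
    then show "\<forall>\<^sub>F N in sequentially. finite {- int N..int N} \<and> X \<subseteq> {- int N..int N} \<and> {- int N..int N} \<subseteq> UNIV"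
      by (intro eventually_sequentiallyI [of M]) force
  qed
  then show ?thesis
    using assms unfolding has_pv_def has_sum_def by (rule filterlim_compose [rotated])
qed

lemma sum_symmetric_Suc:
  fixes f :: "int \<Rightarrow> real"
  shows "(\<Sum>n\<in>{- int (Suc N)..int (Suc N)}. f n) =
    (\<Sum>n\<in>{- int N..int N}. f n) + f (int (Suc N)) + f (- int (Suc N))"
proof -
  have "{- int (Suc N)..int (Suc N)} = insert (int (Suc N)) (insert (- int (Suc N)) {- int N..int N})"
    by auto
  then show ?thesis
    by simp
qed

lemma has_pv_reflect:
  assumes "f has_pv L"
  shows "(\<lambda>n. f (- n)) has_pv L"
proof -
  have "(\<Sum>n\<in>{- int N..int N}. f (- n)) = (\<Sum>n\<in>{- int N..int N}. f n)" for N
    by (induction N) (simp_all only: sum_symmetric_Suc, simp_all add: add.commute)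
  with assms show ?thesis
    by (simp add: has_pv_def)
qed

text \<open>Shifting the window by one drops the term at \<open>- N\<close> and gains the one at
  \<open>N + 1\<close>; decay at both ends makes this change vanish in the limit.\<close>

lemma has_pv_shift:
  assumes "f has_pv L" "(\<lambda>N. f (int N)) \<longlonglongrightarrow> 0" "(\<lambda>N. f (- int N)) \<longlonglongrightarrow> 0"
  shows "(\<lambda>n. f (n + 1)) has_pv L"
proof -
  have "(\<Sum>n\<in>{- int N..int N}. f (n + 1)) =
      (\<Sum>n\<in>{- int N..int N}. f n) - f (- int N) + f (int (Suc N))" for N
  proof (induction N)
    case (Suc N)
    have "- int (Suc N) + 1 = - int N" "int (Suc N) + 1 = int (Suc (Suc N))"
      by simp_all
    then show ?case
      by (simp only: sum_symmetric_Suc Suc.IH)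
  qed simp
  moreover have "(\<lambda>N. (\<Sum>n\<in>{- int N..int N}. f n) - f (- int N) + f (int (Suc N)))
      \<longlonglongrightarrow> L - 0 + 0"
    using assms unfolding has_pv_def
    by (intro tendsto_add tendsto_diff LIMSEQ_Suc [where f = "\<lambda>N. f (int N)"])
  ultimately show ?thesis
    by (simp add: has_pv_def)
qed

text \<open>
  The principal value of \<open>\<Sum> 1 / (a n + r)\<^sup>j\<close> over the integers, for \<open>a \<in> {1, 2, 3}\<close> only;
  a vanishing denominator contributes 0. The division by \<open>a - 1\<close> is harmless, as \<open>a = 1\<close>
  divides every \<open>r\<close>.
\<close>

definition residue_sum :: "nat \<Rightarrow> int \<Rightarrow> int \<Rightarrow> real" where
  "residue_sum j a r =
     (if even j then
        (if a dvd r then 2 / of_int a ^ j else 2 * (1 - 1 / of_int a ^ j) / of_int (a - 1)) * zeta_real j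
      else if a = 3 then chi r * L_real j else 0)"

lemma residue_sum_add: "residue_sum j a (r + a) = residue_sum j a r"
  by (auto simp: residue_sum_def chi_def)

lemma residue_sum_minus: "residue_sum j a (- r) = (- 1) ^ j * residue_sum j a r"
proof -
  have "chi (- r) = - chi r"
  proof -
    have "r mod 3 \<in> {0, 1, 2}" "(- r) mod 3 = (3 - r mod 3) mod 3"
      by (auto simp: mod_simps)
    then show ?thesis
      unfolding chi_def by (elim insertE emptyE; simp)
  qed
  then show ?thesis
    by (auto simp: residue_sum_def)
qed

lemma inverse_linear_tendsto_0:
  fixes a r :: int
  assumes "j \<ge> 1" "a \<noteq> 0"
  shows "(\<lambda>N. 1 / real_of_int (a * int N + r) ^ j) \<longlonglongrightarrow> 0"
proof -
  have "filterlim (\<lambda>N. real_of_int a * real N + real_of_int r) at_infinity sequentially"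
  proof (rule tendsto_add_filterlim_at_infinity' [OF _ tendsto_const])
    show "filterlim (\<lambda>N. real_of_int a * real N) at_infinity sequentially"
      using assms filterlim_real_sequentially
      by (intro tendsto_mult_filterlim_at_infinity [OF tendsto_const])
        (auto intro: filterlim_at_top_imp_at_infinity)
  qed
  then have "filterlim (\<lambda>N. real_of_int (a * int N + r)) at_infinity sequentially"
    by simp
  then have "(\<lambda>N. inverse (real_of_int (a * int N + r))) \<longlonglongrightarrow> 0"
    by (rule filterlim_compose [OF tendsto_inverse_0])
  then have "(\<lambda>N. inverse (real_of_int (a * int N + r)) ^ j) \<longlonglongrightarrow> 0 ^ j"
    by (rule tendsto_power)
  then show ?thesis
    using assms by (simp add: divide_inverse power_inverse power_0_left)
qed

text \<open>The terms at \<open>n\<close> and \<open>- n\<close> are equal for even \<open>j\<close>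
  and cancel for odd \<open>j\<close>; the term at \<open>n = 0\<close> is
  \<open>1 / 0 = 0\<close>.\<close>

lemma has_pv_residue_0:
  assumes "j \<ge> 1" "a \<in> {1, 2, 3}"
  shows "(\<lambda>n. 1 / real_of_int (a * n) ^ j) has_pv residue_sum j a 0"
proof (cases "even j")
  case True
  then have "j \<ge> 2"
    using assms by (cases "j = 1") auto
  have "(\<Sum>n\<in>{- int N..int N}. 1 / real_of_int (a * n) ^ j)
      = (2 / of_int a ^ j) * (\<Sum>n<N. 1 / real (Suc n) ^ j)" for N
  proof (induction N)
    case (Suc N)
    have "1 / real_of_int (a * int (Suc N)) ^ j = 1 / of_int a ^ j * (1 / real (Suc N) ^ j)"
      by (simp add: power_mult_distrib)
    moreover have "real_of_int (a * - int (Suc N)) ^ j = real_of_int (a * int (Suc N)) ^ j"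
      using True by (simp only: mult_minus_right of_int_minus power_minus_even)
    ultimately show ?case
      by (simp only: sum_symmetric_Suc Suc.IH) (simp add: algebra_simps)
  qed (use \<open>j \<ge> 1\<close> in \<open>simp add: power_0_left\<close>)
  moreover have "(\<lambda>N. (2 / of_int a ^ j) * (\<Sum>n<N. 1 / real (Suc n) ^ j))
      \<longlonglongrightarrow> (2 / of_int a ^ j) * zeta_real j"
    using zeta_real_sums [OF \<open>j \<ge> 2\<close>] unfolding sums_def by (rule tendsto_mult_left)
  moreover have "residue_sum j a 0 = (2 / of_int a ^ j) * zeta_real j"
    using True by (simp add: residue_sum_def)
  ultimately show ?thesis
    by (simp only: has_pv_def)
next
  case False
  have "(\<Sum>n\<in>{- int N..int N}. 1 / real_of_int (a * n) ^ j) = 0" for N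
  proof (induction N)
    case (Suc N)
    have "real_of_int (a * - int (Suc N)) ^ j = - (real_of_int (a * int (Suc N)) ^ j)"
      by (simp only: mult_minus_right of_int_minus power_minus_odd [OF False])
    with Suc show ?case
      by (simp only: sum_symmetric_Suc)
  qed (use \<open>j \<ge> 1\<close> in \<open>simp add: power_0_left\<close>)
  moreover have "residue_sum j a 0 = 0"
    using False by (simp add: residue_sum_def chi_def)
  ultimately show ?thesis
    by (simp add: has_pv_def)
qed

lemma has_pv_subseq:
  assumes "f has_pv L" "filterlim h sequentially sequentially"
  shows "(\<lambda>N. \<Sum>n\<in>{- int (h N)..int (h N)}. f n) \<longlonglongrightarrow> L"
  using assms unfolding has_pv_def by (rule filterlim_compose)

text \<open>The odd numbers \<open>2 * n + 1\<close> run from \<open>- 2 * N + 1\<close> to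
  \<open>2 * N + 1\<close>, one step beyond the symmetric window on the right. Modulo 3, with the
  residues 0, 1 and -1, the windows fit exactly.\<close>

lemma sum_symmetric_mod_2:
  fixes g :: "int \<Rightarrow> real"
  shows "(\<Sum>n\<in>{- int N..int N}. g (2 * n)) + (\<Sum>n\<in>{- int N..int N}. g (2 * n + 1)) =
    (\<Sum>l\<in>{- int (2 * N)..int (2 * N)}. g l) + g (2 * int N + 1)"
proof (induction N)
  case (Suc N)
  have "2 * Suc N = Suc (Suc (2 * N))"
    by simp
  then show ?case
    using Suc.IH by (simp only: sum_symmetric_Suc) (simp add: algebra_simps)
qed simp

lemma sum_symmetric_mod_3:
  fixes g :: "int \<Rightarrow> real"
  shows "(\<Sum>n\<in>{- int N..int N}. g (3 * n)) + (\<Sum>n\<in>{- int N..int N}. g (3 * n + 1)) +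
      (\<Sum>n\<in>{- int N..int N}. g (3 * n - 1)) =
    (\<Sum>l\<in>{- int (3 * N + 1)..int (3 * N + 1)}. g l)"
proof (induction N)
  case 0
  have "{- 1..1::int} = {- 1, 0, 1}"
    by auto
  then show ?case
    by simp
next
  case (Suc N)
  have "3 * Suc N + 1 = Suc (Suc (Suc (3 * N + 1)))"
    by simp
  then show ?case
    using Suc.IH by (simp only: sum_symmetric_Suc) (simp add: algebra_simps)
qed

text \<open>For even \<open>j\<close> the sum over all integers is reduced by that over the even
  ones. For odd \<open>j\<close> the terms at \<open>n\<close> and \<open>- n - 1\<close> cancel,
  leaving only the endpoint term \<open>1 / (2 * N + 1) ^ j\<close>.\<close>

lemma has_pv_half:
  assumes "j \<ge> 1"
  shows "(\<lambda>n. 1 / real_of_int (2 * n + 1) ^ j) has_pv residue_sum j 2 1"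
proof (cases "even j")
  case True
  let ?g = "\<lambda>l. 1 / real_of_int l ^ j"
  have "?g has_pv residue_sum j 1 0"
    using has_pv_residue_0 [of j 1] assms by simp
  then have "(\<lambda>N. \<Sum>l\<in>{- int (2 * N)..int (2 * N)}. ?g l) \<longlonglongrightarrow> residue_sum j 1 0"
    by (rule has_pv_subseq) (auto intro!: filterlim_subseq strict_monoI)
  moreover have "(\<lambda>N. \<Sum>n\<in>{- int N..int N}. ?g (2 * n)) \<longlonglongrightarrow> residue_sum j 2 0"
    using has_pv_residue_0 [of j 2] assms by (simp add: has_pv_def)
  moreover have "(\<lambda>N. ?g (2 * int N + 1)) \<longlonglongrightarrow> 0"
    using inverse_linear_tendsto_0 [of j 2 1] assms by simp
  ultimately have "(\<lambda>N. (\<Sum>l\<in>{- int (2 * N)..int (2 * N)}. ?g l) + ?g (2 * int N + 1) -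
      (\<Sum>n\<in>{- int N..int N}. ?g (2 * n))) \<longlonglongrightarrow> residue_sum j 1 0 + 0 - residue_sum j 2 0"
    by (intro tendsto_add tendsto_diff)
  moreover have "residue_sum j 1 0 + 0 - residue_sum j 2 0 = residue_sum j 2 1"
    using True by (simp add: residue_sum_def algebra_simps)
  ultimately show ?thesis
    by (simp only: has_pv_def sum_symmetric_mod_2 [of ?g, symmetric]) simp
next
  case False
  have "(\<Sum>n\<in>{- int N..int N}. 1 / real_of_int (2 * n + 1) ^ j) = 1 / real_of_int (2 * int N + 1) ^ j" for N
  proof (induction N)
    case (Suc N)
    have "real_of_int (2 * - int (Suc N) + 1) ^ j = - (real_of_int (2 * int N + 1) ^ j)"
    proof -
      have "real_of_int (2 * - int (Suc N) + 1) = - real_of_int (2 * int N + 1)"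
        by simp
      then show ?thesis
        by (simp only: power_minus_odd [OF False])
    qed
    with Suc show ?case
      by (simp only: sum_symmetric_Suc)
  qed simp
  moreover have "residue_sum j 2 1 = 0"
    using False by (simp add: residue_sum_def)
  ultimately show ?thesis
    using inverse_linear_tendsto_0 [of j 2 1] assms by (simp add: has_pv_def)
qed

text \<open>For even \<open>j\<close> the classes 1 and -1 modulo 3 have equal sums, each half of
  what the multiples of 3 leave over. For odd \<open>j\<close> a negative \<open>3 * n + 1\<close>
  is minus a positive integer congruent to 2, so folding onto the positive integers produces the
  signs of \<open>chi\<close> and hence \<open>L_real j\<close>.\<close>

lemma has_pv_third:
  assumes "j \<ge> 1"
  shows "(\<lambda>n. 1 / real_of_int (3 * n + 1) ^ j) has_pv residue_sum j 3 1"
proof (cases "even j")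
  case True
  let ?g = "\<lambda>l. 1 / real_of_int l ^ j"
  have "?g has_pv residue_sum j 1 0"
    using has_pv_residue_0 [of j 1] assms by simp
  then have "(\<lambda>N. \<Sum>l\<in>{- int (3 * N + 1)..int (3 * N + 1)}. ?g l) \<longlonglongrightarrow> residue_sum j 1 0"
    by (rule has_pv_subseq) (auto intro!: filterlim_subseq strict_monoI)
  moreover have "(\<lambda>N. \<Sum>n\<in>{- int N..int N}. ?g (3 * n)) \<longlonglongrightarrow> residue_sum j 3 0"
    using has_pv_residue_0 [of j 3] assms by (simp add: has_pv_def)
  ultimately have "(\<lambda>N. ((\<Sum>l\<in>{- int (3 * N + 1)..int (3 * N + 1)}. ?g l) -
      (\<Sum>n\<in>{- int N..int N}. ?g (3 * n))) / 2) \<longlonglongrightarrow> (residue_sum j 1 0 - residue_sum j 3 0) / 2"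
    by (intro tendsto_divide tendsto_diff) auto
  moreover have "(residue_sum j 1 0 - residue_sum j 3 0) / 2 = residue_sum j 3 1"
    using True by (simp add: residue_sum_def algebra_simps)
  moreover have "(\<Sum>n\<in>{- int N..int N}. ?g (3 * n - 1)) = (\<Sum>n\<in>{- int N..int N}. ?g (3 * n + 1))" for N
  proof (rule sum.reindex_bij_witness [of _ uminus uminus])
    fix n :: int
    have "real_of_int (3 * - n + 1) = - real_of_int (3 * n - 1)"
      by simp
    then show "?g (3 * - n + 1) = ?g (3 * n - 1)"
      using True by (simp only: power_minus_even)
  qed auto
  ultimately show ?thesis
    by (simp only: has_pv_def sum_symmetric_mod_3 [of ?g, symmetric]) simp
next
  case False
  have "(\<Sum>n\<in>{- int N..int N}. 1 / real_of_int (3 * n + 1) ^ j) =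
      (\<Sum>l<3 * N + 1. chi (int (Suc l)) / real (Suc l) ^ j)" for N
  proof (induction N)
    case 0
    then show ?case
      by (simp add: chi_def)
  next
    case (Suc N)
    have eq: "3 * Suc N + 1 = Suc (Suc (Suc (3 * N + 1)))"
      by simp
    have "int (Suc (3 * N + 1)) mod 3 = 2" "int (Suc (Suc (3 * N + 1))) mod 3 = 0"
      "int (Suc (Suc (Suc (3 * N + 1)))) mod 3 = 1"
      by presburger+
    then have chi: "chi (int (Suc (3 * N + 1))) = - 1" "chi (int (Suc (Suc (3 * N + 1)))) = 0"
      "chi (int (Suc (Suc (Suc (3 * N + 1))))) = 1"
      by (simp_all only: chi_def) simp_all
    have "real_of_int (3 * - int (Suc N) + 1) = - real (Suc (3 * N + 1))"
      by simp
    then have "real_of_int (3 * - int (Suc N) + 1) ^ j = - (real (Suc (3 * N + 1)) ^ j)"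
      by (simp only: power_minus_odd [OF False])
    moreover have "real_of_int (3 * int (Suc N) + 1) = real (Suc (Suc (Suc (3 * N + 1))))"
      by simp
    ultimately show ?case
      by (simp only: sum_symmetric_Suc Suc.IH eq sum.lessThan_Suc chi)
  qed
  moreover have "(\<lambda>N. \<Sum>l<3 * N + 1. chi (int (Suc l)) / real (Suc l) ^ j) \<longlonglongrightarrow> L_real j"
    using L_real_sums [OF assms] unfolding sums_def
    by (rule filterlim_compose) (auto intro!: filterlim_subseq strict_monoI)
  moreover have "residue_sum j 3 1 = L_real j"
    using False by (simp add: residue_sum_def chi_def)
  ultimately show ?thesis
    by (simp only: has_pv_def)
qed

text \<open>Replacing \<open>n\<close> by \<open>- n\<close> passes from \<open>r\<close> to
  \<open>- r\<close>, and replacing \<open>n\<close> by \<open>n + 1\<close> passes from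
  \<open>r\<close> to \<open>r + a\<close>. Since \<open>a\<close> is at most 3, the residues 0 and
  1 generate all others.\<close>

theorem has_pv_residue_sum:
  assumes j: "j \<ge> 1" and a: "a \<in> {1, 2, 3}"
  shows "(\<lambda>n. 1 / real_of_int (a * n + r) ^ j) has_pv residue_sum j a r"
proof -
  define P where "P r \<longleftrightarrow> (\<lambda>n. 1 / real_of_int (a * n + r) ^ j) has_pv residue_sum j a r" for r
  have reflect: "P (- r)" if "P r" for r
  proof -
    have "(\<lambda>n. 1 / real_of_int (a * - n + r) ^ j) has_pv residue_sum j a r"
      using that unfolding P_def by (rule has_pv_reflect)
    then have "(\<lambda>n. (- 1) ^ j * (1 / real_of_int (a * - n + r) ^ j)) has_pv ((- 1) ^ j * residue_sum j a r)"
      by (rule has_pv_cmult)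
    moreover have "(- 1) ^ j * (1 / real_of_int (a * - n + r) ^ j) = 1 / real_of_int (a * n + - r) ^ j" for n
    proof -
      have "real_of_int (a * n + - r) ^ j = (- 1 * real_of_int (a * - n + r)) ^ j"
        by simp
      also have "\<dots> = (- 1) ^ j * real_of_int (a * - n + r) ^ j"
        by (rule power_mult_distrib)
      finally show ?thesis
        by (cases "even j") auto
    qed
    ultimately show ?thesis
      by (simp only: P_def residue_sum_minus)
  qed
  have shift: "P (r + a)" if "P r" for r
  proof -
    have "(\<lambda>n. 1 / real_of_int (a * (n + 1) + r) ^ j) has_pv residue_sum j a r"
      using that inverse_linear_tendsto_0 [of j a r] inverse_linear_tendsto_0 [of j "- a" r] j a
      unfolding P_def by (intro has_pv_shift) auto
    moreover have "a * (n + 1) + r = a * n + (r + a)" for n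
      by (simp add: algebra_simps)
    ultimately show ?thesis
      by (simp only: P_def residue_sum_add)
  qed
  have unshift: "P (r - a)" if "P r" for r
    using reflect [OF shift [OF reflect [OF that]]] by simp
  have shifts: "P (r + q * a)" if "P r" for r q
  proof (induction q rule: int_induct [of _ 0])
    case base
    then show ?case
      using that by simp
  next
    case (step1 i)
    then show ?case
      using shift [of "r + i * a"] by (simp add: algebra_simps)
  next
    case (step2 i)
    then show ?case
      using unshift [of "r + i * a"] by (simp add: algebra_simps)
  qed
  have P0: "P 0"
    using has_pv_residue_0 [OF j a] by (simp add: P_def)
  have P1: "P 1" if "a \<noteq> 1"
    using that a has_pv_half [OF j] has_pv_third [OF j] by (auto simp: P_def)
  \<comment> \<open>Here 2 is reached as \<open>- 1 + 3\<close>.\<close>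
  have P2: "P 2" if "a = 3"
    using shift [OF reflect [OF P1]] that by simp
  have "r mod a = 0 \<or> a \<noteq> 1 \<and> r mod a = 1 \<or> a = 3 \<and> r mod a = 2"
    using a by auto
  then have "P (r mod a)"
    using P0 P1 P2 by auto
  from shifts [OF this, of "r div a"] show ?thesis
    by (simp add: P_def)
qed

subsection \<open>Partial fractions\<close>

text \<open>\<open>K i\<close> bounds the pole order at the form \<open>l i\<close>. The identity is
  asked for only away from the poles, where the convention \<open>1 / 0 = 0\<close> does not
  interfere.\<close>

definition pf_span :: "('i \<Rightarrow> real \<Rightarrow> real) \<Rightarrow> ('i \<Rightarrow> nat) \<Rightarrow> 'i set \<Rightarrow> (real \<Rightarrow> real) set" where
  "pf_span l K I = {g. \<exists>c. (\<forall>i s. c i s \<in> \<rat>) \<and>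
     (\<forall>x. (\<forall>i\<in>I. l i x \<noteq> 0) \<longrightarrow> g x = (\<Sum>i\<in>I. \<Sum>s = 1..K i. c i s / l i x ^ s))}"

lemma pf_span_cong:
  assumes "f \<in> pf_span l K I" "\<And>x. (\<And>i. i \<in> I \<Longrightarrow> l i x \<noteq> 0) \<Longrightarrow> g x = f x"
  shows "g \<in> pf_span l K I"
  using assms by (auto simp: pf_span_def)

lemma pf_span_add:
  assumes "f \<in> pf_span l K I" "g \<in> pf_span l K I"
  shows "(\<lambda>x. f x + g x) \<in> pf_span l K I"
proof -
  from assms obtain c d where "\<forall>i s. c i s \<in> \<rat>" "\<forall>i s. d i s \<in> \<rat>"
    "\<forall>x. (\<forall>i\<in>I. l i x \<noteq> 0) \<longrightarrow> f x = (\<Sum>i\<in>I. \<Sum>s = 1..K i. c i s / l i x ^ s)"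
    "\<forall>x. (\<forall>i\<in>I. l i x \<noteq> 0) \<longrightarrow> g x = (\<Sum>i\<in>I. \<Sum>s = 1..K i. d i s / l i x ^ s)"
    unfolding pf_span_def by blast
  then show ?thesis
    unfolding pf_span_def
    by (intro CollectI exI [of _ "\<lambda>i s. c i s + d i s"]) (simp add: add_divide_distrib sum.distrib)
qed

lemma pf_span_cmult:
  assumes "f \<in> pf_span l K I" "q \<in> \<rat>"
  shows "(\<lambda>x. q * f x) \<in> pf_span l K I"
proof -
  from assms obtain c where "\<forall>i s. c i s \<in> \<rat>"
    "\<forall>x. (\<forall>i\<in>I. l i x \<noteq> 0) \<longrightarrow> f x = (\<Sum>i\<in>I. \<Sum>s = 1..K i. c i s / l i x ^ s)"
    unfolding pf_span_def by blast
  with assms(2) show ?thesis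
    unfolding pf_span_def
    by (intro CollectI exI [of _ "\<lambda>i s. q * c i s"]) (simp add: sum_distrib_left)
qed

lemma pf_span_zero: "(\<lambda>x. 0) \<in> pf_span l K I"
  unfolding pf_span_def by (intro CollectI exI [of _ "\<lambda>i s. 0"]) simp

lemma pf_span_sum:
  assumes "\<And>i. i \<in> A \<Longrightarrow> f i \<in> pf_span l K I"
  shows "(\<lambda>x. \<Sum>i\<in>A. f i x) \<in> pf_span l K I"
  using assms
  by (induction A rule: infinite_finite_induct) (simp_all add: pf_span_zero pf_span_add)

lemma pf_span_basic:
  assumes "finite I" "i \<in> I" "s \<in> {1..K i}"
  shows "(\<lambda>x. 1 / l i x ^ s) \<in> pf_span l K I"
proof -
  have "(\<Sum>j\<in>I. \<Sum>t = 1..K j. (if j = i \<and> t = s then 1 else 0) / l j x ^ t) = 1 / l i x ^ s" for x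
  proof -
    have "(\<Sum>t = 1..K j. (if j = i \<and> t = s then 1 else 0) / l j x ^ t) =
        (if j = i then 1 / l i x ^ s else 0)" for j
    proof (cases "j = i")
      case True
      then have "(\<Sum>t = 1..K j. (if j = i \<and> t = s then 1 else 0) / l j x ^ t) =
          (\<Sum>t = 1..K i. if t = s then 1 / l i x ^ s else 0)"
        by (intro sum.cong) auto
      also have "\<dots> = 1 / l i x ^ s"
        using assms(3) by (subst sum.delta) auto
      finally show ?thesis
        using True by simp
    qed simp
    then show ?thesis
      using assms(1,2) by simp
  qed
  then show ?thesis
    unfolding pf_span_def
    by (intro CollectI exI [of _ "\<lambda>j t. if j = i \<and> t = s then 1 else 0"]) auto
qed

text \<open>The combination \<open>a i * l j x - a j * l i x\<close> is the nonzero constant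
  \<open>D = a i * b j - a j * b i\<close>. Multiplying by it and dividing by \<open>D\<close>
  lowers one of the two exponents in each resulting term, so induction on \<open>p + q\<close>
  applies.\<close>

lemma pf_span_two:
  fixes a b :: "'i \<Rightarrow> int"
  defines "l \<equiv> \<lambda>i x. of_int (a i) * x + of_int (b i)"
  assumes "finite I" "i \<in> I" "j \<in> I" "a i * b j \<noteq> a j * b i"
  shows "p \<le> K i \<Longrightarrow> q \<le> K j \<Longrightarrow> p + q > 0 \<Longrightarrow>
    (\<lambda>x. 1 / (l i x ^ p * l j x ^ q)) \<in> pf_span l K I"
proof (induction "p + q" arbitrary: p q rule: less_induct)
  case less
  consider "p = 0" | "q = 0" | p' q' where "p = Suc p'" "q = Suc q'"
    by (meson not0_implies_Suc)
  then show ?case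
  proof cases
    case 1
    then show ?thesis
      using less.prems pf_span_basic [of I j q K l] assms by auto
  next
    case 2
    then show ?thesis
      using less.prems pf_span_basic [of I i p K l] assms by auto
  next
    case 3
    define D where "D = real_of_int (a i * b j - a j * b i)"
    have "D \<noteq> 0"
      using assms(5) by (simp only: D_def of_int_eq_0_iff)
    have 1: "(\<lambda>x. 1 / (l i x ^ p * l j x ^ q')) \<in> pf_span l K I"
      using less.prems 3 by (intro less.hyps) auto
    have 2: "(\<lambda>x. 1 / (l i x ^ p' * l j x ^ q)) \<in> pf_span l K I"
      using less.prems 3 by (intro less.hyps) auto
    have "(\<lambda>x. of_int (a i) / D * (1 / (l i x ^ p * l j x ^ q')) +
        (- of_int (a j) / D) * (1 / (l i x ^ p' * l j x ^ q))) \<in> pf_span l K I"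
      by (intro pf_span_add pf_span_cmult 1 2) (simp_all add: D_def)
    then show ?thesis
    proof (rule pf_span_cong)
      fix x
      assume nz: "\<And>i. i \<in> I \<Longrightarrow> l i x \<noteq> 0"
      have "l i x \<noteq> 0" "l j x \<noteq> 0"
        using nz assms by auto
      have eq: "D = of_int (a i) * l j x - of_int (a j) * l i x"
        by (simp add: D_def l_def algebra_simps)
      have "of_int (a i) / D * (1 / (l i x ^ p * l j x ^ q')) +
          (- of_int (a j) / D) * (1 / (l i x ^ p' * l j x ^ q)) =
          (of_int (a i) * l j x - of_int (a j) * l i x) / (D * (l i x ^ p * l j x ^ q))"
        using \<open>D \<noteq> 0\<close> \<open>l i x \<noteq> 0\<close> \<open>l j x \<noteq> 0\<close> 3 by (simp add: field_simps)
      also have "\<dots> = 1 / (l i x ^ p * l j x ^ q)"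
        using \<open>D \<noteq> 0\<close> by (simp add: eq [symmetric])
      finally show "1 / (l i x ^ p * l j x ^ q) =
          of_int (a i) / D * (1 / (l i x ^ p * l j x ^ q')) +
          (- of_int (a j) / D) * (1 / (l i x ^ p' * l j x ^ q))"
        by (rule sym)
    qed
  qed
qed

text \<open>Multiplying a decomposition over \<open>J\<close> by the power of a new form gives terms
  that involve only two forms each, which \<open>pf_span_two\<close> splits.\<close>

lemma pf_span_prod:
  fixes a b :: "'i \<Rightarrow> int"
  defines "l \<equiv> \<lambda>i x. of_int (a i) * x + of_int (b i)"
  assumes "finite I" "I \<noteq> {}"
    and "\<And>i. i \<in> I \<Longrightarrow> K i \<ge> 1"
    and "\<And>i j. i \<in> I \<Longrightarrow> j \<in> I \<Longrightarrow> i \<noteq> j \<Longrightarrow> a i * b j \<noteq> a j * b i"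
  shows "(\<lambda>x. 1 / (\<Prod>i\<in>I. l i x ^ K i)) \<in> pf_span l K I"
  using assms(2-5)
proof (induction I rule: finite_ne_induct)
  case (singleton i)
  then show ?case
    using pf_span_basic [of "{i}" i "K i" K l] by auto
next
  case (insert i J)
  have "(\<lambda>x. 1 / (\<Prod>i\<in>J. l i x ^ K i)) \<in> pf_span l K J"
    by (rule insert.IH) (use insert.prems in auto)
  then obtain c where c: "\<And>i s. c i s \<in> \<rat>"
    and eq: "\<And>x. (\<forall>i\<in>J. l i x \<noteq> 0) \<Longrightarrow>
      1 / (\<Prod>i\<in>J. l i x ^ K i) = (\<Sum>i\<in>J. \<Sum>s = 1..K i. c i s / l i x ^ s)"
    unfolding pf_span_def by blast
  have "(\<lambda>x. \<Sum>j\<in>J. \<Sum>s = 1..K j. c j s * (1 / (l i x ^ K i * l j x ^ s))) \<in> pf_span l K (insert i J)"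
  proof (intro pf_span_sum pf_span_cmult c)
    fix j s
    assume j: "j \<in> J" and s: "s \<in> {1..K j}"
    then have "i \<noteq> j"
      using insert.hyps by blast
    with j s show "(\<lambda>x. 1 / (l i x ^ K i * l j x ^ s)) \<in> pf_span l K (insert i J)"
      unfolding l_def using insert.hyps(1) insert.prems(2) by (intro pf_span_two) simp_all
  qed
  then show ?case
  proof (rule pf_span_cong)
    fix x
    assume "\<And>j. j \<in> insert i J \<Longrightarrow> l j x \<noteq> 0"
    then have "1 / (\<Prod>j\<in>J. l j x ^ K j) = (\<Sum>j\<in>J. \<Sum>s = 1..K j. c j s / l j x ^ s)"
      by (intro eq) auto
    moreover have "1 / (\<Prod>j\<in>insert i J. l j x ^ K j) = 1 / l i x ^ K i * (1 / (\<Prod>j\<in>J. l j x ^ K j))"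
      using insert.hyps by simp
    ultimately have "1 / (\<Prod>j\<in>insert i J. l j x ^ K j) =
        1 / l i x ^ K i * (\<Sum>j\<in>J. \<Sum>s = 1..K j. c j s / l j x ^ s)"
      by (simp only:)
    then show "1 / (\<Prod>j\<in>insert i J. l j x ^ K j) =
        (\<Sum>j\<in>J. \<Sum>s = 1..K j. c j s * (1 / (l i x ^ K i * l j x ^ s)))"
      by (simp add: sum_distrib_left)
  qed
qed

text \<open>The one-variable decomposition is evaluated at \<open>x = n / m\<close>; homogeneity of
  degree \<open>sum K I\<close> then fixes the power of \<open>m\<close> in each term.\<close>

theorem partial_fractions_homogeneous:
  fixes a b :: "'i \<Rightarrow> int"
  assumes I: "finite I" "I \<noteq> {}"
    and K: "\<And>i. i \<in> I \<Longrightarrow> K i \<ge> 1"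
    and indep: "\<And>i j. i \<in> I \<Longrightarrow> j \<in> I \<Longrightarrow> i \<noteq> j \<Longrightarrow> a i * b j \<noteq> a j * b i"
  obtains c :: "'i \<Rightarrow> nat \<Rightarrow> real" where "\<And>i s. c i s \<in> \<rat>"
    and "\<And>m n. m \<noteq> 0 \<Longrightarrow> (\<And>i. i \<in> I \<Longrightarrow> of_int (a i) * n + of_int (b i) * m \<noteq> 0) \<Longrightarrow>
      1 / (\<Prod>i\<in>I. (of_int (a i) * n + of_int (b i) * m) ^ K i) =
      (\<Sum>i\<in>I. \<Sum>s = 1..K i. c i s / (m ^ (sum K I - s) * (of_int (a i) * n + of_int (b i) * m) ^ s))"
proof -
  let ?l = "\<lambda>i x::real. of_int (a i) * x + of_int (b i)"
  have "(\<lambda>x. 1 / (\<Prod>i\<in>I. ?l i x ^ K i)) \<in> pf_span ?l K I"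
    using assms by (intro pf_span_prod) auto
  then obtain c where c: "\<And>i s. c i s \<in> \<rat>"
    and eq: "\<And>x. (\<forall>i\<in>I. ?l i x \<noteq> 0) \<Longrightarrow>
      1 / (\<Prod>i\<in>I. ?l i x ^ K i) = (\<Sum>i\<in>I. \<Sum>s = 1..K i. c i s / ?l i x ^ s)"
    unfolding pf_span_def by blast
  show ?thesis
  proof
    fix m n :: real
    assume m: "m \<noteq> 0" and nz: "\<And>i. i \<in> I \<Longrightarrow> of_int (a i) * n + of_int (b i) * m \<noteq> 0"
    have l: "of_int (a i) * n + of_int (b i) * m = m * ?l i (n / m)" for i
      using m by (simp add: field_simps)
    have "(\<Prod>i\<in>I. (of_int (a i) * n + of_int (b i) * m) ^ K i) = (\<Prod>i\<in>I. ?l i (n / m) ^ K i) * m ^ sum K I"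
      by (simp only: l power_mult_distrib prod.distrib power_sum) (rule mult.commute)
    then have "1 / (\<Prod>i\<in>I. (of_int (a i) * n + of_int (b i) * m) ^ K i) =
        1 / (\<Prod>i\<in>I. ?l i (n / m) ^ K i) / m ^ sum K I"
      by (simp only: divide_divide_eq_left)
    also have "1 / (\<Prod>i\<in>I. ?l i (n / m) ^ K i) = (\<Sum>i\<in>I. \<Sum>s = 1..K i. c i s / ?l i (n / m) ^ s)"
    proof (rule eq)
      show "\<forall>i\<in>I. ?l i (n / m) \<noteq> 0"
        using nz m unfolding l by simp
    qed
    also have "\<dots> / m ^ sum K I = (\<Sum>i\<in>I. \<Sum>s = 1..K i. c i s / (m ^ sum K I * ?l i (n / m) ^ s))"
      by (simp only: sum_divide_distrib divide_divide_eq_left mult.commute)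
    also have "\<dots> = (\<Sum>i\<in>I. \<Sum>s = 1..K i.
        c i s / (m ^ (sum K I - s) * (of_int (a i) * n + of_int (b i) * m) ^ s))"
    proof (intro sum.cong refl)
      fix i s
      assume i: "i \<in> I" and s: "s \<in> {1..K i}"
      have "K i \<le> sum K I"
        using i I by (intro member_le_sum) auto
      then have "m ^ sum K I = m ^ (sum K I - s) * m ^ s"
        using s by (simp flip: power_add)
      then show "c i s / (m ^ sum K I * ?l i (n / m) ^ s) =
          c i s / (m ^ (sum K I - s) * (of_int (a i) * n + of_int (b i) * m) ^ s)"
        by (simp only: l power_mult_distrib mult.assoc)
    qed
    finally show "1 / (\<Prod>i\<in>I. (of_int (a i) * n + of_int (b i) * m) ^ K i) = \<dots>" .
  qed (rule c)
qed

subsection \<open>The rational span\<close>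

definition parity_span :: "nat \<Rightarrow> real set" where
  "parity_span k = {x. \<exists>a b :: nat \<Rightarrow> rat.
     x = (\<Sum>n = 0..(k - 3) div 2. of_rat (a n) * (zeta_real (2 * n) * zeta_real (k - 2 * n))) +
       (\<Sum>n = 0..(k - 3) div 2. of_rat (b n) * (L_real (2 * n + 1) * L_real (k - 2 * n - 1)))}"

lemma parity_span_add:
  assumes "x \<in> parity_span k" "y \<in> parity_span k"
  shows "x + y \<in> parity_span k"
proof -
  from assms obtain a b a' b' :: "nat \<Rightarrow> rat" where
    "x = (\<Sum>n = 0..(k - 3) div 2. of_rat (a n) * (zeta_real (2 * n) * zeta_real (k - 2 * n))) +
       (\<Sum>n = 0..(k - 3) div 2. of_rat (b n) * (L_real (2 * n + 1) * L_real (k - 2 * n - 1)))"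
    "y = (\<Sum>n = 0..(k - 3) div 2. of_rat (a' n) * (zeta_real (2 * n) * zeta_real (k - 2 * n))) +
       (\<Sum>n = 0..(k - 3) div 2. of_rat (b' n) * (L_real (2 * n + 1) * L_real (k - 2 * n - 1)))"
    unfolding parity_span_def by blast
  then show ?thesis
    unfolding parity_span_def
    by (intro CollectI exI [of _ "\<lambda>n. a n + a' n"] exI [of _ "\<lambda>n. b n + b' n"])
      (simp add: of_rat_add distrib_right sum.distrib)
qed

lemma parity_span_cmult:
  assumes "x \<in> parity_span k" "q \<in> \<rat>"
  shows "q * x \<in> parity_span k"
proof -
  from assms(1) obtain a b :: "nat \<Rightarrow> rat" where
    "x = (\<Sum>n = 0..(k - 3) div 2. of_rat (a n) * (zeta_real (2 * n) * zeta_real (k - 2 * n))) +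
       (\<Sum>n = 0..(k - 3) div 2. of_rat (b n) * (L_real (2 * n + 1) * L_real (k - 2 * n - 1)))"
    unfolding parity_span_def by blast
  moreover from assms(2) obtain r where "q = of_rat r"
    by (auto simp: Rats_def)
  ultimately show ?thesis
    unfolding parity_span_def
    by (intro CollectI exI [of _ "\<lambda>n. r * a n"] exI [of _ "\<lambda>n. r * b n"])
      (simp add: of_rat_mult distrib_left sum_distrib_left mult.assoc)
qed

lemma parity_span_zero: "0 \<in> parity_span k"
  unfolding parity_span_def by (intro CollectI exI [of _ "\<lambda>n. 0"]) simp

lemma parity_span_zeta:
  assumes "odd k" "even j" "j + 3 \<le> k"
  shows "zeta_real j * zeta_real (k - j) \<in> parity_span k"
proof -
  obtain n where j: "j = 2 * n"
    using assms by blast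
  then have n: "n \<le> (k - 3) div 2"
    using assms by linarith
  have "(\<Sum>i = 0..(k - 3) div 2. of_rat (if i = n then 1 else 0) * (zeta_real (2 * i) * zeta_real (k - 2 * i)))
      = (\<Sum>i = 0..(k - 3) div 2. if i = n then zeta_real j * zeta_real (k - j) else 0)"
    by (intro sum.cong) (auto simp: j)
  also have "\<dots> = zeta_real j * zeta_real (k - j)"
    using n by (subst sum.delta) auto
  finally show ?thesis
    unfolding parity_span_def
    by (intro CollectI exI [of _ "\<lambda>i. if i = n then 1 else 0"] exI [of _ "\<lambda>i. 0"]) simp
qed

lemma parity_span_L:
  assumes "odd k" "odd j" "j + 2 \<le> k"
  shows "L_real j * L_real (k - j) \<in> parity_span k"
proof -
  obtain n where j: "j = 2 * n + 1"
    using assms by (auto elim: oddE)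
  then have n: "n \<le> (k - 3) div 2"
    using assms by linarith
  have "(\<Sum>i = 0..(k - 3) div 2. of_rat (if i = n then 1 else 0) * (L_real (2 * i + 1) * L_real (k - 2 * i - 1)))
      = (\<Sum>i = 0..(k - 3) div 2. if i = n then L_real j * L_real (k - j) else 0)"
    by (intro sum.cong) (auto simp: j)
  also have "\<dots> = L_real j * L_real (k - j)"
    using n by (subst sum.delta) auto
  finally show ?thesis
    unfolding parity_span_def
    by (intro CollectI exI [of _ "\<lambda>i. 0"] exI [of _ "\<lambda>i. if i = n then 1 else 0"]) simp
qed

text \<open>Convergence and membership of the value are carried together, so that termwise rational
  combinations need no separate convergence argument.\<close>

definition sums_in_span :: "nat \<Rightarrow> (int \<Rightarrow> real) set" where
  "sums_in_span k = {g. \<exists>x\<in>parity_span k. (g has_sum x) {0<..}}"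

lemma sums_in_span_cong:
  assumes "f \<in> sums_in_span k" "\<And>m. m > 0 \<Longrightarrow> f m = g m"
  shows "g \<in> sums_in_span k"
  using assms has_sum_cong [of "{0<..}" f g] by (auto simp: sums_in_span_def)

lemma sums_in_span_add:
  "f \<in> sums_in_span k \<Longrightarrow> g \<in> sums_in_span k \<Longrightarrow> (\<lambda>m. f m + g m) \<in> sums_in_span k"
  unfolding sums_in_span_def using has_sum_add parity_span_add by fastforce

lemma sums_in_span_cmult:
  "f \<in> sums_in_span k \<Longrightarrow> q \<in> \<rat> \<Longrightarrow> (\<lambda>m. q * f m) \<in> sums_in_span k"
  unfolding sums_in_span_def using has_sum_cmult_right parity_span_cmult by fastforce

lemma sums_in_span_diff:
  assumes "f \<in> sums_in_span k" "g \<in> sums_in_span k"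
  shows "(\<lambda>m. f m - g m) \<in> sums_in_span k"
  using sums_in_span_add [OF assms(1) sums_in_span_cmult [OF assms(2), of "- 1"]] by simp

lemma sums_in_span_sum:
  assumes "\<And>i. i \<in> I \<Longrightarrow> f i \<in> sums_in_span k"
  shows "(\<lambda>m. \<Sum>i\<in>I. f i m) \<in> sums_in_span k"
proof -
  have "(\<lambda>m. 0) \<in> sums_in_span k"
    unfolding sums_in_span_def using parity_span_zero by (auto intro!: bexI [of _ 0])
  with assms show ?thesis
    by (induction I rule: infinite_finite_induct) (simp_all add: sums_in_span_add)
qed

lemma has_sum_positive_int:
  fixes f :: "int \<Rightarrow> real"
  assumes "(\<lambda>n. f (int (Suc n))) sums S" "summable (\<lambda>n. norm (f (int (Suc n))))"
  shows "(f has_sum S) {0<..}"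
proof -
  have "((\<lambda>n. f (int (Suc n))) has_sum S) UNIV"
    using assms by (intro norm_summable_imp_has_sum)
  moreover have "bij_betw (\<lambda>n. int (Suc n)) UNIV {0<..}"
    by (rule bij_betw_byWitness [of _ "\<lambda>m. nat m - 1"]) auto
  ultimately show ?thesis
    using has_sum_reindex_bij_betw [of "\<lambda>n. int (Suc n)" UNIV "{0<..}" f S] by blast
qed

lemma has_sum_zeta:
  assumes "s \<ge> 2"
  shows "((\<lambda>m. 1 / real_of_int m ^ s) has_sum zeta_real s) {0<..}"
  using zeta_real_sums [OF assms] by (intro has_sum_positive_int) (auto simp: sums_iff)

text \<open>Only the multiples of \<open>a\<close> contribute; substituting \<open>a * m\<close> for
  \<open>m\<close> extracts the factor \<open>1 / a ^ s\<close>.\<close>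

lemma has_sum_zeta_dvd:
  assumes "s \<ge> 2" "a > 0"
  shows "((\<lambda>m. of_bool (a dvd m) / real_of_int m ^ s) has_sum (1 / of_int a ^ s * zeta_real s)) {0<..}"
proof -
  have "((\<lambda>m. 1 / of_int a ^ s * (1 / real_of_int m ^ s)) has_sum (1 / of_int a ^ s * zeta_real s)) {0<..}"
    by (intro has_sum_cmult_right has_sum_zeta assms)
  also have "(\<lambda>m. 1 / of_int a ^ s * (1 / real_of_int m ^ s)) = (\<lambda>m. 1 / real_of_int m ^ s) \<circ> (*) a"
    by (auto simp: power_mult_distrib)
  finally have "((\<lambda>m. 1 / real_of_int m ^ s) has_sum (1 / of_int a ^ s * zeta_real s)) ((*) a ` {0<..})"
    using assms by (subst has_sum_reindex) (auto intro: inj_onI simp: o_def)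
  then show ?thesis
    by (rule has_sum_cong_neutral [THEN iffD1, rotated -1])
      (use assms in \<open>auto simp: zero_less_mult_iff elim!: dvdE\<close>)
qed

lemma has_sum_L:
  assumes "s \<ge> 2"
  shows "((\<lambda>m. chi m / real_of_int m ^ s) has_sum L_real s) {0<..}"
proof (rule has_sum_positive_int)
  show "(\<lambda>n. chi (int (Suc n)) / real_of_int (int (Suc n)) ^ s) sums L_real s"
    using L_real_sums [of s] assms by simp
  show "summable (\<lambda>n. norm (chi (int (Suc n)) / real_of_int (int (Suc n)) ^ s))"
  proof (rule summable_comparison_test')
    show "summable (\<lambda>n. 1 / real (Suc n) ^ s)"
      using zeta_real_sums [OF assms] by (simp add: sums_iff)
    show "norm (norm (chi (int (Suc n)) / real_of_int (int (Suc n)) ^ s)) \<le> 1 / real (Suc n) ^ s" for n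
      by (simp add: chi_def)
  qed
qed

text \<open>The moduli 2 and 3 are prime, and \<open>a = 1\<close> contradicts the
  assumption.\<close>

lemma dvd_mult_small:
  fixes a b m :: int
  assumes "a \<in> {1, 2, 3}" "\<not> a dvd b"
  shows "a dvd b * m \<longleftrightarrow> a dvd m"
proof -
  have "prime (2::int)" "prime (3::int)"
    by simp_all
  then show ?thesis
    using assms prime_dvd_mult_iff [of a b m] by (elim insertE) auto
qed

text \<open>This handles the points where a form vanishes. The sum is a rational multiple of
  \<open>zeta_real k\<close>, which lies in the span through the product with index 0, as
  \<open>zeta_real 0 = - 1 / 2\<close>.\<close>

lemma sums_in_span_dvd:
  assumes k: "odd k" "k \<ge> 3" and a: "a \<in> {1, 2, 3}"
  shows "(\<lambda>m. of_bool (a dvd b * m) / real_of_int m ^ k) \<in> sums_in_span k"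
proof -
  have zeta: "q * zeta_real k \<in> parity_span k" if "q \<in> \<rat>" for q
  proof -
    have "(- 2 * q) * (zeta_real 0 * zeta_real (k - 0)) \<in> parity_span k"
      using k that by (intro parity_span_cmult parity_span_zeta) auto
    then show ?thesis
      by (simp add: zeta_real_def)
  qed
  show ?thesis
  proof (cases "a dvd b")
    case True
    then show ?thesis
      using has_sum_zeta [of k] k zeta [of 1] by (auto simp: sums_in_span_def)
  next
    case False
    then show ?thesis
      using has_sum_zeta_dvd [of k a] k a zeta [of "1 / of_int a ^ k"]
      unfolding sums_in_span_def by (auto simp: dvd_mult_small [OF a False])
  qed
qed

text \<open>For even \<open>j\<close> the factor depends on \<open>m\<close> only through whether
  \<open>a\<close> divides \<open>b * m\<close>, so the sum over \<open>m\<close> is a rational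
  multiple of \<open>zeta_real j * zeta_real s\<close>. For odd \<open>j\<close> multiplicativity of
  \<open>chi\<close> isolates \<open>chi m\<close>, whose sum is \<open>L_real s\<close>.\<close>

lemma sums_in_span_residue_sum:
  assumes k: "odd k" "k = j + s" and js: "j \<ge> 1" "s \<ge> 2" and a: "a \<in> {1, 2, 3}"
  shows "(\<lambda>m. residue_sum j a (b * m) / real_of_int m ^ s) \<in> sums_in_span k"
proof (cases "even j")
  case True
  \<comment> \<open>Here \<open>s\<close> is odd, because \<open>k\<close> is odd and
    \<open>j\<close> is even.\<close>
  then have "s \<ge> 3"
    using k js by (cases "s = 2") auto
  then have zeta: "zeta_real j * zeta_real s \<in> parity_span k"
    using parity_span_zeta [of k j] True k by auto
  have one: "(\<lambda>m. zeta_real j * (1 / real_of_int m ^ s)) \<in> sums_in_span k"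
    unfolding sums_in_span_def using zeta has_sum_cmult_right [OF has_sum_zeta [OF js(2)]] by blast
  have dvd: "(\<lambda>m. zeta_real j * (of_bool (a dvd m) / real_of_int m ^ s)) \<in> sums_in_span k"
  proof -
    have "1 / of_int a ^ s * (zeta_real j * zeta_real s) \<in> parity_span k"
      by (intro parity_span_cmult zeta) simp
    then have "zeta_real j * (1 / of_int a ^ s * zeta_real s) \<in> parity_span k"
      by (simp add: ac_simps)
    moreover have "((\<lambda>m. zeta_real j * (of_bool (a dvd m) / real_of_int m ^ s)) has_sum
        zeta_real j * (1 / of_int a ^ s * zeta_real s)) {0<..}"
      using a by (intro has_sum_cmult_right has_sum_zeta_dvd js) auto
    ultimately show ?thesis
      unfolding sums_in_span_def by blast
  qed
  \<comment> \<open>These are the coefficients in \<open>residue_sum\<close> for residues divisible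
    and not divisible by \<open>a\<close>; the second case below uses
    \<open>v + (u - v) * of_bool (a dvd m)\<close>.\<close>
  define u v where "u = 2 / real_of_int a ^ j" and "v = 2 * (1 - 1 / real_of_int a ^ j) / of_int (a - 1)"
  have uv: "u \<in> \<rat>" "v \<in> \<rat>"
    by (simp_all add: u_def v_def)
  show ?thesis
  proof (cases "a dvd b")
    case dvd_b: True
    have "(\<lambda>m. u * (zeta_real j * (1 / real_of_int m ^ s))) \<in> sums_in_span k"
      by (intro sums_in_span_cmult one uv)
    then show ?thesis
      by (rule sums_in_span_cong) (use dvd_b True in \<open>simp add: residue_sum_def u_def\<close>)
  next
    case False
    have "(\<lambda>m. v * (zeta_real j * (1 / real_of_int m ^ s)) +
        (u - v) * (zeta_real j * (of_bool (a dvd m) / real_of_int m ^ s))) \<in> sums_in_span k"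
      by (intro sums_in_span_add sums_in_span_cmult one dvd uv Rats_diff)
    then show ?thesis
    proof (rule sums_in_span_cong)
      fix m :: int
      have "residue_sum j a (b * m) = (if a dvd m then u else v) * zeta_real j"
        unfolding residue_sum_def dvd_mult_small [OF a False] using True by (simp add: u_def v_def)
      then show "v * (zeta_real j * (1 / real_of_int m ^ s)) +
          (u - v) * (zeta_real j * (of_bool (a dvd m) / real_of_int m ^ s)) =
          residue_sum j a (b * m) / real_of_int m ^ s"
        by (cases "a dvd m") (simp_all add: left_diff_distrib diff_divide_distrib)
    qed
  qed
next
  case False
  define w where "w = (if a = 3 then chi b else 0)"
  have "w \<in> \<rat>"
    by (simp add: w_def chi_def)
  have "L_real j * L_real s \<in> parity_span k"
    using parity_span_L [of k j] False k js by auto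
  then have "(\<lambda>m. L_real j * (chi m / real_of_int m ^ s)) \<in> sums_in_span k"
    unfolding sums_in_span_def using has_sum_cmult_right [OF has_sum_L [OF js(2)]] by blast
  then have "(\<lambda>m. w * (L_real j * (chi m / real_of_int m ^ s))) \<in> sums_in_span k"
    using \<open>w \<in> \<rat>\<close> by (rule sums_in_span_cmult)
  then show ?thesis
    by (rule sums_in_span_cong) (use False in \<open>simp add: residue_sum_def w_def chi_mult\<close>)
qed

subsection \<open>Half-plane sums\<close>

text \<open>The equation has at most one integer solution \<open>n\<close>, and it has one exactly
  when \<open>a\<close> divides \<open>B\<close>.\<close>

lemma has_pv_indicator:
  fixes a B :: int
  assumes "a \<noteq> 0"
  shows "(\<lambda>n. of_bool (a * n + B = 0)) has_pv of_bool (a dvd B)"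
proof (cases "a dvd B")
  case True
  then obtain q where B: "B = a * q" ..
  have eq: "a * n + B = 0 \<longleftrightarrow> n = - q" for n
  proof -
    have "a * n + B = a * (n + q)"
      by (simp add: B distrib_left)
    then show ?thesis
      using assms by (simp add: eq_neg_iff_add_eq_0)
  qed
  have "((\<lambda>n. of_bool (a * n + B = 0)) has_sum (1::real)) UNIV"
    unfolding eq by (intro has_sum_finite_neutralI [of "{- q}"]) auto
  then show ?thesis
    using True by (simp add: has_sum_imp_has_pv)
next
  case False
  then have "a * n + B \<noteq> 0" for n
    by (metis add.commute add_eq_0_iff dvd_minus_iff dvd_triv_left)
  then show ?thesis
    using False by (simp add: has_pv_def)
qed

text \<open>Absolute convergence permits summing first over \<open>n\<close> and then over
  \<open>m\<close>. The inner sum is evaluated through partial fractions as a principal value, and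
  every resulting function of \<open>m\<close> has its sum in the span.\<close>

lemma half_plane_sum_in_parity_span:
  fixes a b :: "'i \<Rightarrow> int" and I :: "'i set" and K :: "'i \<Rightarrow> nat" and k0 :: nat
  defines "f \<equiv> \<lambda>m n. 1 / (real_of_int m ^ k0 * (\<Prod>i\<in>I. of_int (a i * n + b i * m) ^ K i))"
  assumes I: "finite I" "card I \<ge> 2"
    and K: "\<And>i. i \<in> I \<Longrightarrow> K i \<ge> 1" and "k0 \<ge> 1"
    and a: "\<And>i. i \<in> I \<Longrightarrow> a i \<in> {1, 2, 3}"
    and indep: "\<And>i j. i \<in> I \<Longrightarrow> j \<in> I \<Longrightarrow> i \<noteq> j \<Longrightarrow> a i * b j \<noteq> a j * b i"
    and k: "odd k" "k = k0 + sum K I"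
    and summable: "(\<lambda>(m, n). f m n) summable_on {0<..} \<times> UNIV"
  shows "(\<Sum>\<^sub>\<infinity>(m, n)\<in>{0<..} \<times> UNIV. f m n) \<in> parity_span k"
proof -
  have "I \<noteq> {}"
    using I by auto
  \<comment> \<open>A second form and the factor \<open>m ^ k0\<close> each contribute at least 1 to
    \<open>k\<close>. Hence every exponent \<open>k - s\<close> of \<open>m\<close> below is at
    least 2, and the outer sums converge absolutely.\<close>
  have K_le: "K i + 2 \<le> k" if "i \<in> I" for i
  proof -
    have "I - {i} \<noteq> {}"
      using I that by (metis One_nat_def Suc_1 card.empty card_Suc_Diff1 Suc_n_not_le_n)
    then have "sum K (I - {i}) > 0"
      using I K by (intro sum_pos) force+
    then show ?thesis
      using I that \<open>k0 \<ge> 1\<close> by (simp add: k sum.remove [of I i])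
  qed
  obtain c where c: "\<And>i s. c i s \<in> \<rat>"
    and pf: "\<And>m n :: real. m \<noteq> 0 \<Longrightarrow> (\<And>i. i \<in> I \<Longrightarrow> of_int (a i) * n + of_int (b i) * m \<noteq> 0) \<Longrightarrow>
      1 / (\<Prod>i\<in>I. (of_int (a i) * n + of_int (b i) * m) ^ K i) =
      (\<Sum>i\<in>I. \<Sum>s = 1..K i. c i s / (m ^ (sum K I - s) * (of_int (a i) * n + of_int (b i) * m) ^ s))"
    using partial_fractions_homogeneous [of I K a b] I K indep \<open>I \<noteq> {}\<close> by blast
  \<comment> \<open>the value of the partial fraction sum, times \<open>m\<^sup>k\<close>, on the line where the form \<open>j\<close> vanishes\<close>
  define r where
    "r j = (\<Sum>i\<in>I. \<Sum>s = 1..K i. c i s / (of_int (b i) - of_int (a i) * of_int (b j) / of_int (a j)) ^ s)" for j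
  have r: "r j \<in> \<rat>" for j
    unfolding r_def by (intro Rats_sum Rats_divide Rats_power Rats_diff Rats_mult Rats_of_int c)
  define T where
    "T m = (\<Sum>i\<in>I. \<Sum>s = 1..K i. c i s * (residue_sum s (a i) (b i * m) / real_of_int m ^ (k - s))) -
      (\<Sum>j\<in>I. r j * (of_bool (a j dvd b j * m) / real_of_int m ^ k))" for m
  \<comment> \<open>The subtracted sum makes the identity valid for all \<open>n\<close>. Where the
    form \<open>j\<close> vanishes, \<open>f m n = 0\<close>, but the partial fractions still add up
    to \<open>r j / m ^ k\<close>: their terms with \<open>i = j\<close> are 0, and so are those in
    \<open>r j\<close>, again by \<open>1 / 0 = 0\<close>.\<close>
  have f_eq: "f m n = (\<Sum>i\<in>I. \<Sum>s = 1..K i. c i s / of_int m ^ (k - s) * (1 / of_int (a i * n + b i * m) ^ s)) -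
      (\<Sum>j\<in>I. r j / of_int m ^ k * of_bool (a j * n + b j * m = 0))" if "m > 0" for m n
  proof (cases "\<exists>j\<in>I. a j * n + b j * m = 0")
    case False
    have "f m n = 1 / of_int m ^ k0 *
        (1 / (\<Prod>i\<in>I. (of_int (a i) * of_int n + of_int (b i) * of_int m) ^ K i))"
      by (simp add: f_def)
    also have "1 / (\<Prod>i\<in>I. (of_int (a i) * of_int n + of_int (b i) * of_int m) ^ K i) =
        (\<Sum>i\<in>I. \<Sum>s = 1..K i. c i s / (real_of_int m ^ (sum K I - s) *
          (of_int (a i) * of_int n + of_int (b i) * of_int m) ^ s))"
    proof (rule pf)
      fix i
      assume "i \<in> I"
      with False have "real_of_int (a i * n + b i * m) \<noteq> 0"
        by (subst of_int_eq_0_iff) blast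
      then show "real_of_int (a i) * of_int n + of_int (b i) * of_int m \<noteq> 0"
        by simp
    qed (use that in simp)
    also have "1 / of_int m ^ k0 * \<dots> =
        (\<Sum>i\<in>I. \<Sum>s = 1..K i. c i s / of_int m ^ (k - s) * (1 / of_int (a i * n + b i * m) ^ s))"
      unfolding sum_distrib_left
    proof (intro sum.cong refl)
      fix i s
      assume "i \<in> I" "s \<in> {1..K i}"
      then have "s \<le> sum K I"
        using I member_le_sum [of i I K] by auto
      then have "real_of_int m ^ (k - s) = of_int m ^ k0 * of_int m ^ (sum K I - s)"
        by (simp add: k flip: power_add)
      then show "1 / of_int m ^ k0 * (c i s / (real_of_int m ^ (sum K I - s) *
            (of_int (a i) * of_int n + of_int (b i) * of_int m) ^ s)) =
          c i s / of_int m ^ (k - s) * (1 / of_int (a i * n + b i * m) ^ s)"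
        by simp
    qed
    moreover have "(\<Sum>j\<in>I. r j / of_int m ^ k * of_bool (a j * n + b j * m = 0)) = 0"
      using False by (intro sum.neutral) auto
    ultimately show ?thesis
      by simp
  next
    case True
    then obtain j where j: "j \<in> I" "a j * n + b j * m = 0"
      by blast
    have "a j \<noteq> 0"
      using a [OF j(1)] by auto
    have "real_of_int (a j * n + b j * m) ^ K j = 0"
      unfolding j(2) using K [OF j(1)] by simp
    then have "(\<Prod>i\<in>I. real_of_int (a i * n + b i * m) ^ K i) = 0"
      using I(1) j(1) by (intro prod_zero) blast+
    then have "f m n = 0"
      by (simp only: f_def) simp
    moreover have "(\<Sum>i\<in>I. r i / of_int m ^ k * of_bool (a i * n + b i * m = 0)) =
        (\<Sum>i\<in>I. if i = j then r j / of_int m ^ k else 0)"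
    proof (intro sum.cong refl)
      fix i
      assume "i \<in> I"
      have "a i * n + b i * m \<noteq> 0" if "i \<noteq> j"
      proof
        assume "a i * n + b i * m = 0"
        with j(2) have "a j * (a i * n + b i * m) - a i * (a j * n + b j * m) = 0"
          by simp
        then have "(a j * b i - a i * b j) * m = 0"
          by (simp add: algebra_simps)
        then show False
          using indep [of i j] \<open>i \<in> I\<close> j(1) that \<open>m > 0\<close> by simp
      qed
      then show "r i / of_int m ^ k * of_bool (a i * n + b i * m = 0) =
          (if i = j then r j / of_int m ^ k else 0)"
        using j(2) by auto
    qed
    moreover have "(\<Sum>i\<in>I. if i = j then r j / real_of_int m ^ k else 0) = r j / of_int m ^ k"
      using I j(1) by simp
    moreover have "(\<Sum>i\<in>I. \<Sum>s = 1..K i. c i s / of_int m ^ (k - s) * (1 / of_int (a i * n + b i * m) ^ s)) =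
        r j / real_of_int m ^ k"
      unfolding r_def sum_divide_distrib
    proof (intro sum.cong refl)
      fix i s
      assume "i \<in> I" "s \<in> {1..K i}"
      then have "real_of_int m ^ k = of_int m ^ (k - s) * of_int m ^ s"
        using K_le [of i] by (simp flip: power_add)
      moreover have "real_of_int (a i * n + b i * m) =
          of_int m * (of_int (b i) - of_int (a i) * of_int (b j) / of_int (a j))"
      proof -
        have "real_of_int (a j) * of_int n = - (of_int (b j) * of_int m)"
          using j(2) by (metis add_eq_0_iff2 of_int_minus of_int_mult)
        then have "real_of_int n = - (of_int (b j) * of_int m) / of_int (a j)"
          using \<open>a j \<noteq> 0\<close> by (simp add: field_simps)
        then show ?thesis
          by (simp add: algebra_simps)
      qed
      ultimately show "c i s / of_int m ^ (k - s) * (1 / of_int (a i * n + b i * m) ^ s) =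
          c i s / (of_int (b i) - of_int (a i) * of_int (b j) / of_int (a j)) ^ s / real_of_int m ^ k"
        by (simp only: power_mult_distrib) (simp add: ac_simps)
    qed
    ultimately show ?thesis
      by simp
  qed
  \<comment> \<open>Both sides are principal values of \<open>f m\<close>: one from its absolute
    convergence, the other from the termwise evaluation of the partial fractions.\<close>
  have f_sum: "(\<Sum>\<^sub>\<infinity>n. f m n) = T m" if "m > 0" for m
  proof (rule has_pv_unique)
    have "f m summable_on UNIV"
      using summable_on_SigmaD1 [OF summable] that by simp
    then show "f m has_pv (\<Sum>\<^sub>\<infinity>n. f m n)"
      by (intro has_sum_imp_has_pv has_sum_infsum)
    have "(\<lambda>n. (\<Sum>i\<in>I. \<Sum>s = 1..K i. c i s / of_int m ^ (k - s) * (1 / of_int (a i * n + b i * m) ^ s)) -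
        (\<Sum>j\<in>I. r j / of_int m ^ k * of_bool (a j * n + b j * m = 0))) has_pv
      ((\<Sum>i\<in>I. \<Sum>s = 1..K i. c i s / of_int m ^ (k - s) * residue_sum s (a i) (b i * m)) -
        (\<Sum>j\<in>I. r j / of_int m ^ k * of_bool (a j dvd b j * m)))"
      using a by (intro has_pv_diff has_pv_sum has_pv_cmult has_pv_residue_sum has_pv_indicator) force+
    also have "((\<Sum>i\<in>I. \<Sum>s = 1..K i. c i s / of_int m ^ (k - s) * residue_sum s (a i) (b i * m)) -
        (\<Sum>j\<in>I. r j / of_int m ^ k * of_bool (a j dvd b j * m))) = T m"
      by (simp add: T_def)
    finally show "f m has_pv T m"
      by (simp only: f_eq [OF that, symmetric])
  qed
  have "T \<in> sums_in_span k"
    unfolding T_def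
  proof (intro sums_in_span_diff sums_in_span_sum sums_in_span_cmult c r)
    fix i s
    assume "i \<in> I" "s \<in> {1..K i}"
    then show "(\<lambda>m. residue_sum s (a i) (b i * m) / real_of_int m ^ (k - s)) \<in> sums_in_span k"
      using K_le [of i] a k(1) by (intro sums_in_span_residue_sum) auto
  next
    fix j
    assume "j \<in> I"
    then show "(\<lambda>m. of_bool (a j dvd b j * m) / real_of_int m ^ k) \<in> sums_in_span k"
      using K_le [of j] K [of j] a k(1) by (intro sums_in_span_dvd) auto
  qed
  then obtain x where x: "x \<in> parity_span k" "(T has_sum x) {0<..}"
    unfolding sums_in_span_def by blast
  have "infsum (\<lambda>(m, n). f m n) ({0<..} \<times> UNIV) = (\<Sum>\<^sub>\<infinity>m\<in>{0<..}. \<Sum>\<^sub>\<infinity>n. f m n)"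
    using infsum_Sigma'_banach [OF summable] by simp
  also have "\<dots> = (\<Sum>\<^sub>\<infinity>m\<in>{0<..}. T m)"
    by (intro infsum_cong f_sum) simp
  also have "\<dots> = x"
    using x(2) by (rule infsumI)
  finally show ?thesis
    using x(1) by simp
qed

subsection \<open>The G2 series\<close>

lemma summable_on_inverse_square_int: "(\<lambda>m::int. 1 / (of_int m)\<^sup>2 :: real) summable_on UNIV"
proof -
  have pos: "(\<lambda>m::int. 1 / (of_int m)\<^sup>2 :: real) summable_on {0<..}"
    using has_sum_zeta [of 2] by (auto simp: summable_on_def)
  also have "?this \<longleftrightarrow> (\<lambda>m::int. 1 / (of_int m)\<^sup>2 :: real) summable_on {..<0}"
    by (rule summable_on_reindex_bij_witness [of _ uminus uminus]) auto
  finally have "(\<lambda>m::int. 1 / (of_int m)\<^sup>2 :: real) summable_on ({0<..} \<union> {..<0})"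
    using pos by (intro summable_on_Un_disjoint) auto
  also have "?this \<longleftrightarrow> (\<lambda>m::int. 1 / (of_int m)\<^sup>2 :: real) summable_on UNIV"
    by (rule summable_on_cong_neutral) auto
  finally show ?thesis .
qed

lemma summable_on_inverse_square_int_pair:
  "(\<lambda>(m, n). 1 / (of_int m * of_int n)\<^sup>2 :: real) summable_on UNIV \<times> UNIV"
proof -
  obtain S where S: "((\<lambda>m::int. 1 / (of_int m)\<^sup>2 :: real) has_sum S) UNIV"
    using summable_on_inverse_square_int by (auto simp: summable_on_def)
  show ?thesis
  proof (rule summable_on_SigmaI)
  show "((\<lambda>n. case (m, n) of (m, n) \<Rightarrow> 1 / (of_int m * of_int n)\<^sup>2) has_sum 1 / (of_int m)\<^sup>2 * S) UNIV"
    for m :: int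
    using has_sum_cmult_right [OF S, of "1 / (of_int m)\<^sup>2"] by (simp add: power_mult_distrib)
  show "(\<lambda>m::int. 1 / (of_int m)\<^sup>2 * S) summable_on UNIV"
    by (intro summable_on_cmult_left summable_on_inverse_square_int)
  qed auto
qed

definition G2_term :: "nat \<Rightarrow> nat \<Rightarrow> nat \<Rightarrow> nat \<Rightarrow> nat \<Rightarrow> nat \<Rightarrow> int \<times> int \<Rightarrow> real" where
  "G2_term k1 k2 k3 k4 k5 k6 = (\<lambda>(m, n).
     1 / (of_int m ^ k1 * of_int n ^ k2 * of_int (m + n) ^ k3 * of_int (m + 2 * n) ^ k4 *
       of_int (m + 3 * n) ^ k5 * of_int (2 * m + 3 * n) ^ k6))"

text \<open>For nonzero integers, \<open>1 / \<bar>xyzw\<bar> \<le> (1 / (xy)\<^sup>2 + 1 / (zw)\<^sup>2) / 2\<close> by AM-GM, and the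
  pairs \<open>(m, n)\<close> and \<open>(m + n, m + 2n)\<close> both run over all of the lattice.\<close>

lemma G2_term_summable:
  assumes "k1 \<ge> 1" "k2 \<ge> 1" "k3 \<ge> 1" "k4 \<ge> 1"
  shows "G2_term k1 k2 k3 k4 k5 k6 summable_on UNIV \<times> UNIV"
proof -
  define g where "g = (\<lambda>(m, n). 1 / (of_int m * of_int n)\<^sup>2 :: real)"
  have g: "g summable_on UNIV \<times> UNIV"
    unfolding g_def by (rule summable_on_inverse_square_int_pair)
  also have "?this \<longleftrightarrow> (\<lambda>(m, n). g (m + n, m + 2 * n)) summable_on UNIV \<times> UNIV"
    by (rule summable_on_reindex_bij_witness
        [of _ "\<lambda>(m, n). (m + n, m + 2 * n)" "\<lambda>(x, y). (2 * x - y, y - x)"]) auto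
  finally have "(\<lambda>(m, n). g (m + n, m + 2 * n)) summable_on UNIV \<times> UNIV" .
  with g have bound: "(\<lambda>p. 1 / 2 * (g p + (case p of (m, n) \<Rightarrow> g (m + n, m + 2 * n)))) summable_on UNIV \<times> UNIV"
    by (intro summable_on_cmult_right summable_on_add)
  have power_ge: "\<bar>real_of_int x\<bar> \<le> \<bar>real_of_int x\<bar> ^ e" if "e \<ge> 1" for x e
    using that by (cases "x = 0") (auto intro!: self_le_power)
  have "(\<lambda>p. norm (G2_term k1 k2 k3 k4 k5 k6 p)) summable_on UNIV \<times> UNIV"
  proof (rule summable_on_comparison_test [OF bound])
    fix p :: "int \<times> int"
    obtain m n where p: "p = (m, n)"
      by fastforce
    define x y z w where "x = \<bar>real_of_int m\<bar>" and "y = \<bar>real_of_int n\<bar>"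
      and "z = \<bar>real_of_int (m + n)\<bar>" and "w = \<bar>real_of_int (m + 2 * n)\<bar>"
    note defs = x_def y_def z_def w_def
    show "norm (G2_term k1 k2 k3 k4 k5 k6 p) \<le> 1 / 2 * (g p + (case p of (m, n) \<Rightarrow> g (m + n, m + 2 * n)))"
    proof (cases "m = 0 \<or> n = 0 \<or> m + n = 0 \<or> m + 2 * n = 0 \<or>
        (of_int (m + 3 * n) ^ k5 * of_int (2 * m + 3 * n) ^ k6 :: real) = 0")
      case True
      then have "G2_term k1 k2 k3 k4 k5 k6 p = 0"
        using assms by (auto simp: G2_term_def p simp del: of_int_add of_int_mult)
      then show ?thesis
        by (simp add: p g_def)
    next
      case False
      define v where "v = \<bar>of_int (m + 3 * n) ^ k5 * of_int (2 * m + 3 * n) ^ k6 :: real\<bar>"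
      have "v = \<bar>real_of_int ((m + 3 * n) ^ k5 * (2 * m + 3 * n) ^ k6)\<bar>"
        by (simp add: v_def)
      moreover have "(m + 3 * n) ^ k5 * (2 * m + 3 * n) ^ k6 \<noteq> 0"
      proof -
        have "real_of_int ((m + 3 * n) ^ k5 * (2 * m + 3 * n) ^ k6) \<noteq> 0"
          using False by (simp only: of_int_mult of_int_power) blast
        then show ?thesis
          by (simp only: of_int_eq_0_iff) blast
      qed
      ultimately have "1 \<le> v"
        by linarith
      have pos: "x > 0" "y > 0" "z > 0" "w > 0"
        using False unfolding defs by (simp_all del: of_int_add of_int_mult)
      have "x * y * z * w * 1 \<le> x ^ k1 * y ^ k2 * z ^ k3 * w ^ k4 * v"
        using assms \<open>1 \<le> v\<close> pos unfolding defs
        by (intro mult_mono power_ge) (auto simp del: of_int_add of_int_mult)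
      then have "1 / (x ^ k1 * y ^ k2 * z ^ k3 * w ^ k4 * v) \<le> 1 / (x * y * z * w)"
        using pos \<open>1 \<le> v\<close> by (intro divide_left_mono) auto
      also have "\<dots> \<le> 1 / 2 * (1 / (x * y)\<^sup>2 + 1 / (z * w)\<^sup>2)"
        using sum_squares_bound [of "1 / (x * y)" "1 / (z * w)"] by (simp add: power_divide mult.assoc)
      also have "\<dots> = 1 / 2 * (g p + (case p of (m, n) \<Rightarrow> g (m + n, m + 2 * n)))"
        unfolding defs g_def p by (simp only: prod.case power_mult_distrib power2_abs)
      also have "x ^ k1 * y ^ k2 * z ^ k3 * w ^ k4 * v = \<bar>real_of_int m ^ k1 * of_int n ^ k2 *
          of_int (m + n) ^ k3 * of_int (m + 2 * n) ^ k4 * of_int (m + 3 * n) ^ k5 * of_int (2 * m + 3 * n) ^ k6\<bar>"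
        unfolding defs v_def by (simp only: abs_mult power_abs mult.assoc)
      finally show ?thesis
        by (simp only: G2_term_def p prod.case real_norm_def abs_divide abs_one)
    qed
  qed auto
  then show ?thesis
    by (rule abs_summable_summable)
qed

section \<open>Oddness and reduction to the two half-planes\<close>

lemma G2_term_minus:
  assumes "odd (k1 + k2 + k3 + k4 + k5 + k6)"
  shows "G2_term k1 k2 k3 k4 k5 k6 (- m, - n) = - G2_term k1 k2 k3 k4 k5 k6 (m, n)"
proof -
  have neg: "real_of_int (- x) ^ e = (- 1) ^ e * of_int x ^ e" for x e
    by (simp flip: power_mult_distrib)
  have forms: "- m + - n = - (m + n)" "- m + 2 * - n = - (m + 2 * n)" "- m + 3 * - n = - (m + 3 * n)"
    "2 * - m + 3 * - n = - (2 * m + 3 * n)"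
    by simp_all
  have "G2_term k1 k2 k3 k4 k5 k6 (- m, - n) = 1 / ((- 1) ^ (k1 + k2 + k3 + k4 + k5 + k6) *
      (of_int m ^ k1 * of_int n ^ k2 * of_int (m + n) ^ k3 * of_int (m + 2 * n) ^ k4 *
       of_int (m + 3 * n) ^ k5 * of_int (2 * m + 3 * n) ^ k6))"
    unfolding G2_term_def prod.case forms neg power_add by (simp only: ac_simps)
  with assms show ?thesis
    by (simp add: G2_term_def)
qed

text \<open>In either half-plane the five forms other than the variable of constant sign contain the
  other variable with coefficient 1, 2 or 3 and are pairwise non-proportional, so the general
  half-plane result applies.\<close>

lemma G2_half_plane_sums:
  assumes k_pos: "k1 \<ge> 1" "k2 \<ge> 1" "k3 \<ge> 1" "k4 \<ge> 1" "k5 \<ge> 1" "k6 \<ge> 1"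
    and k: "k = k1 + k2 + k3 + k4 + k5 + k6" "odd k"
  shows "infsum (G2_term k1 k2 k3 k4 k5 k6) ({0<..} \<times> UNIV) \<in> parity_span k" (is ?A)
    and "infsum (G2_term k1 k2 k3 k4 k5 k6) (UNIV \<times> {0<..}) \<in> parity_span k" (is ?B)
proof -
  let ?G = "G2_term k1 k2 k3 k4 k5 k6"
  have summable: "?G summable_on A \<times> B" for A B
    by (rule summable_on_subset_banach [OF G2_term_summable]) (use k_pos in auto)
  show ?A
  proof -
    \<comment> \<open>A pair \<open>(a, b)\<close> stands for the form \<open>a * n + b * m\<close>;
      thus \<open>(3, 2)\<close> is \<open>2 * m + 3 * n\<close>.\<close>
    define K :: "int \<times> int \<Rightarrow> nat" where
      "K = (\<lambda>p. if p = (1, 0) then k2 else if p = (1, 1) then k3 else if p = (2, 1) then k4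
        else if p = (3, 1) then k5 else k6)"
    let ?I = "{(1, 0), (1, 1), (2, 1), (3, 1), (3, 2)} :: (int \<times> int) set"
    have G: "?G = (\<lambda>(m, n). 1 / (of_int m ^ k1 * (\<Prod>p\<in>?I. of_int (fst p * n + snd p * m) ^ K p)))"
      by (auto simp: fun_eq_iff G2_term_def K_def algebra_simps)
    show ?thesis
      unfolding G
    proof (rule half_plane_sum_in_parity_span)
      show "(\<lambda>(m, n). 1 / (real_of_int m ^ k1 * (\<Prod>p\<in>?I. of_int (fst p * n + snd p * m) ^ K p)))
          summable_on {0<..} \<times> UNIV"
        using summable unfolding G .
      show "odd k"
        by (rule k)
      show "k = k1 + sum K ?I"
        using k(1) by (simp add: K_def)
      show "K p \<ge> 1" for p
        using k_pos by (simp add: K_def)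
      show "fst p \<in> {1, 2, 3}" if "p \<in> ?I" for p
        using that by (elim insertE emptyE) simp_all
      show "fst p * snd q \<noteq> fst q * snd p" if "p \<in> ?I" "q \<in> ?I" "p \<noteq> q" for p q
        using that by (elim insertE emptyE) simp_all
    qed (use k_pos in simp_all)
  qed
  show ?B
  proof -
    \<comment> \<open>Now \<open>(a, b)\<close> stands for \<open>a * m + b * n\<close>, since the
      roles of the variables are exchanged; \<open>(2, 3)\<close> is
      \<open>2 * m + 3 * n\<close>.\<close>
    define K :: "int \<times> int \<Rightarrow> nat" where
      "K = (\<lambda>p. if p = (1, 0) then k1 else if p = (1, 1) then k3 else if p = (1, 2) then k4
        else if p = (1, 3) then k5 else k6)"
    let ?I = "{(1, 0), (1, 1), (1, 2), (1, 3), (2, 3)} :: (int \<times> int) set"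
    have G: "(\<lambda>(n, m). ?G (m, n)) =
        (\<lambda>(n, m). 1 / (of_int n ^ k2 * (\<Prod>p\<in>?I. of_int (fst p * m + snd p * n) ^ K p)))"
      by (auto simp: fun_eq_iff G2_term_def K_def algebra_simps)
    have "(\<lambda>(n, m). ?G (m, n)) summable_on {0<..} \<times> UNIV \<longleftrightarrow> ?G summable_on UNIV \<times> {0<..}"
      by (rule summable_on_reindex_bij_witness [of _ prod.swap prod.swap]) auto
    then have swapped: "(\<lambda>(n, m). ?G (m, n)) summable_on {0<..} \<times> UNIV"
      using summable by simp
    have "infsum (\<lambda>(n, m). ?G (m, n)) ({0<..} \<times> UNIV) \<in> parity_span k"
      unfolding G
    proof (rule half_plane_sum_in_parity_span)
      show "(\<lambda>(n, m). 1 / (real_of_int n ^ k2 * (\<Prod>p\<in>?I. of_int (fst p * m + snd p * n) ^ K p)))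
          summable_on {0<..} \<times> UNIV"
        using swapped unfolding G .
      show "odd k"
        by (rule k)
      show "k = k2 + sum K ?I"
        using k(1) by (simp add: K_def)
      show "K p \<ge> 1" for p
        using k_pos by (simp add: K_def)
      show "fst p \<in> {1, 2, 3}" if "p \<in> ?I" for p
        using that by (elim insertE emptyE) simp_all
      show "fst p * snd q \<noteq> fst q * snd p" if "p \<in> ?I" "q \<in> ?I" "p \<noteq> q" for p q
        using that by (elim insertE emptyE) simp_all
    qed (use k_pos in simp_all)
    also have "infsum (\<lambda>(n, m). ?G (m, n)) ({0<..} \<times> UNIV) = infsum ?G (UNIV \<times> {0<..})"
      by (rule infsum_reindex_bij_witness [of _ prod.swap prod.swap]) auto
    finally show ?thesis .
  qed
qed

lemma G2_chamber_sum_in_parity_span: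
  assumes k_pos: "k1 \<ge> 1" "k2 \<ge> 1" "k3 \<ge> 1" "k4 \<ge> 1" "k5 \<ge> 1" "k6 \<ge> 1"
    and k: "k = k1 + k2 + k3 + k4 + k5 + k6" "odd k"
  shows "infsum (G2_term k1 k2 k3 k4 k5 k6) ({0<..} \<times> {0<..}) \<in> parity_span k"
proof -
  let ?G = "G2_term k1 k2 k3 k4 k5 k6"
  have summable: "?G summable_on A \<times> B" for A B
    by (rule summable_on_subset_banach [OF G2_term_summable]) (use k_pos in auto)
  have minus: "?G (- m, - n) = - ?G (m, n)" for m n
    by (rule G2_term_minus) (rule k(2) [unfolded k(1)])
  have zero: "?G (m, 0) = 0" "?G (0, n) = 0" for m n
    using k_pos by (simp_all add: G2_term_def)
  have "infsum ?G ({0<..} \<times> UNIV) = infsum ?G ({0<..} \<times> {0<..} \<union> {0<..} \<times> {..<0})"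
  proof (rule infsum_cong_neutral)
    fix p :: "int \<times> int"
    assume "p \<in> {0<..} \<times> UNIV - ({0<..} \<times> {0<..} \<union> {0<..} \<times> {..<0})"
    then have "p = (fst p, 0)"
      by (cases p) auto
    then show "?G p = 0"
      using zero by metis
  qed auto
  also have "\<dots> = infsum ?G ({0<..} \<times> {0<..}) + infsum ?G ({0<..} \<times> {..<0})"
    by (intro infsum_Un_disjoint summable) auto
  finally have A: "infsum ?G ({0<..} \<times> UNIV) =
      infsum ?G ({0<..} \<times> {0<..}) + infsum ?G ({0<..} \<times> {..<0})" .
  have "infsum ?G (UNIV \<times> {0<..}) = infsum ?G ({0<..} \<times> {0<..} \<union> {..<0} \<times> {0<..})"
  proof (rule infsum_cong_neutral)
    fix p :: "int \<times> int"
    assume "p \<in> UNIV \<times> {0<..} - ({0<..} \<times> {0<..} \<union> {..<0} \<times> {0<..})"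
    then have "p = (0, snd p)"
      by (cases p) auto
    then show "?G p = 0"
      using zero by metis
  qed auto
  also have "\<dots> = infsum ?G ({0<..} \<times> {0<..}) + infsum ?G ({..<0} \<times> {0<..})"
    by (intro infsum_Un_disjoint summable) auto
  \<comment> \<open>Reflection in the origin carries one mixed quadrant onto the other, and oddness
    supplies the sign. So the mixed quadrant enters \<open>A\<close> and \<open>B\<close> with
    opposite signs.\<close>
  also have "infsum ?G ({..<0} \<times> {0<..}) = infsum (\<lambda>p. - ?G p) ({0<..} \<times> {..<0})"
    by (intro infsum_reindex_bij_witness [of _ "\<lambda>(m, n). (- m, - n)" "\<lambda>(m, n). (- m, - n)"])
      (auto simp: minus)
  finally have B: "infsum ?G (UNIV \<times> {0<..}) =
      infsum ?G ({0<..} \<times> {0<..}) - infsum ?G ({0<..} \<times> {..<0})"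
    by (simp add: infsum_uminus)
  have "infsum ?G ({0<..} \<times> {0<..}) =
      1 / 2 * (infsum ?G ({0<..} \<times> UNIV) + infsum ?G (UNIV \<times> {0<..}))"
    by (simp add: A B)
  also have "\<dots> \<in> parity_span k"
    by (intro parity_span_cmult parity_span_add G2_half_plane_sums assms) simp
  finally show ?thesis .
qed

section \<open>Passage from the real sums to the complex functions\<close>

lemma of_nat_powr_of_nat:
  "n > 0 \<Longrightarrow> (of_nat n :: complex) powr of_nat j = of_real (real n ^ j)"
  by (simp add: powr_nat')

lemma zeta_G2_of_nat:
  assumes "k1 \<ge> 1" "k2 \<ge> 1" "k3 \<ge> 1" "k4 \<ge> 1"
  shows "zeta_G2 (of_nat k1) (of_nat k2) (of_nat k3) (of_nat k4) (of_nat k5) (of_nat k6) =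
    of_real (infsum (G2_term k1 k2 k3 k4 k5 k6) ({0<..} \<times> {0<..}))"
proof -
  let ?G = "G2_term k1 k2 k3 k4 k5 k6"
  have "?G summable_on {0<..} \<times> {0<..}"
    by (rule summable_on_subset_banach [OF G2_term_summable]) (use assms in auto)
  then have "((\<lambda>p. of_real (?G p) :: complex) has_sum of_real (infsum ?G ({0<..} \<times> {0<..}))) ({0<..} \<times> {0<..})"
    by (intro has_sum_of_real has_sum_infsum)
  then have "((\<lambda>p. of_real (?G (map_prod int int p)) :: complex) has_sum
      of_real (infsum ?G ({0<..} \<times> {0<..}))) ({0<..} \<times> {0<..})"
    by (subst has_sum_reindex_bij_witness [of _ "map_prod nat nat" "map_prod int int"]) auto
  then have "(\<Sum>\<^sub>\<infinity>p\<in>{0<..} \<times> {0<..}. of_real (?G (map_prod int int p)) :: complex) =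
      of_real (infsum ?G ({0<..} \<times> {0<..}))"
    by (rule infsumI)
  moreover have "zeta_G2 (of_nat k1) (of_nat k2) (of_nat k3) (of_nat k4) (of_nat k5) (of_nat k6) =
      (\<Sum>\<^sub>\<infinity>p\<in>{0<..} \<times> {0<..}. of_real (?G (map_prod int int p)))"
    unfolding zeta_G2_def
  proof (intro infsum_cong, clarify)
    fix m n :: nat
    assume "m > 0" "n > 0"
    then show "1 / (complex_of_nat m powr of_nat k1 * of_nat n powr of_nat k2 * of_nat (m + n) powr of_nat k3 *
        of_nat (m + 2 * n) powr of_nat k4 * of_nat (m + 3 * n) powr of_nat k5 *
        of_nat (2 * m + 3 * n) powr of_nat k6) = of_real (?G (map_prod int int (m, n)))"
      by (simp add: of_nat_powr_of_nat G2_term_def del: of_nat_add of_nat_mult) simp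
  qed
  ultimately show ?thesis
    by simp
qed

lemma zeta_of_nat: "j \<noteq> 1 \<Longrightarrow> zeta (of_nat j) = of_real (zeta_real j)"
proof (cases "j = 0")
  case False
  assume "j \<noteq> 1"
  with False have "(\<lambda>n. of_real (1 / real (Suc n) ^ j) :: complex) sums of_real (zeta_real j)"
    by (intro sums_of_real zeta_real_sums) auto
  moreover have "(of_real (1 / real (Suc n) ^ j) :: complex) = 1 / of_nat (Suc n) powr of_nat j" for n
    by (simp add: of_nat_powr_of_nat del: of_nat_Suc)
  ultimately show ?thesis
    using False by (simp only: zeta_def sums_iff) simp
qed (simp add: zeta_def zeta_real_def)

lemma L_chi3_of_nat:
  assumes "j \<ge> 1"
  shows "L_chi3 (of_nat j) = of_real (L_real j)"
proof -
  have "(\<lambda>n. of_real (chi (int (Suc n)) / real (Suc n) ^ j) :: complex) sums of_real (L_real j)"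
    by (intro sums_of_real L_real_sums assms)
  moreover have "(of_real (chi (int (Suc n)) / real (Suc n) ^ j) :: complex) =
      chi3 (Suc n) / of_nat (Suc n) powr of_nat j" for n
  proof -
    have "int (Suc n) mod 3 = int (Suc n mod 3)"
      by (simp only: of_nat_mod of_nat_numeral)
    then have "chi3 (Suc n) = of_real (chi (int (Suc n)))"
      unfolding chi3_def chi_def by (simp del: of_nat_Suc)
    then show ?thesis
      by (simp add: of_nat_powr_of_nat del: of_nat_Suc)
  qed
  ultimately show ?thesis
    by (simp only: L_chi3_def sums_iff)
qed

theorem theorem5p1:
  fixes k1 k2 k3 k4 k5 k6 k :: nat
  assumes "k1 \<ge> 1" "k2 \<ge> 1" "k3 \<ge> 1" "k4 \<ge> 1" "k5 \<ge> 1" "k6 \<ge> 1"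
    and "k = k1 + k2 + k3 + k4 + k5 + k6"
    and "odd k"
  shows "\<exists>a b :: nat \<Rightarrow> rat.
    zeta_G2 (of_nat k1) (of_nat k2) (of_nat k3) (of_nat k4) (of_nat k5) (of_nat k6) =
      (\<Sum>n = 0..(k - 3) div 2. of_rat (a n) * (zeta (of_nat (2 * n)) * zeta (of_nat (k - 2 * n)))) +
      (\<Sum>n = 0..(k - 3) div 2.
         of_rat (b n) * (L_chi3 (of_nat (2 * n + 1)) * L_chi3 (of_nat (k - 2 * n - 1))))"
proof -
  obtain a b :: "nat \<Rightarrow> rat" where
    ab: "infsum (G2_term k1 k2 k3 k4 k5 k6) ({0<..} \<times> {0<..}) =
       (\<Sum>n = 0..(k - 3) div 2. of_rat (a n) * (zeta_real (2 * n) * zeta_real (k - 2 * n))) +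
       (\<Sum>n = 0..(k - 3) div 2. of_rat (b n) * (L_real (2 * n + 1) * L_real (k - 2 * n - 1)))"
    using G2_chamber_sum_in_parity_span [OF assms] unfolding parity_span_def by blast
  have of_real_of_rat: "complex_of_real (of_rat q) = of_rat q" for q
    by (cases q) (simp add: of_rat_rat)
  have zeta_part: "complex_of_real (\<Sum>n = 0..(k - 3) div 2. of_rat (a n) * (zeta_real (2 * n) * zeta_real (k - 2 * n))) =
      (\<Sum>n = 0..(k - 3) div 2. of_rat (a n) * (zeta (of_nat (2 * n)) * zeta (of_nat (k - 2 * n))))"
    unfolding of_real_sum
  proof (intro sum.cong refl)
    fix n
    assume "n \<in> {0..(k - 3) div 2}"
    \<comment> \<open>Since \<open>k\<close> is odd and greater than 3, the range of
      \<open>n\<close> gives \<open>k - 2 * n \<ge> 3\<close>, which avoids the divergent case of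
      \<open>zeta\<close>.\<close>
    then have "k - 2 * n \<noteq> 1" "2 * n \<noteq> 1"
      using assms by auto
    then show "complex_of_real (of_rat (a n) * (zeta_real (2 * n) * zeta_real (k - 2 * n))) =
        of_rat (a n) * (zeta (of_nat (2 * n)) * zeta (of_nat (k - 2 * n)))"
      by (simp only: zeta_of_nat of_real_mult of_real_of_rat not_False_eq_True)
  qed
  have L_part: "complex_of_real (\<Sum>n = 0..(k - 3) div 2. of_rat (b n) * (L_real (2 * n + 1) * L_real (k - 2 * n - 1))) =
      (\<Sum>n = 0..(k - 3) div 2. of_rat (b n) * (L_chi3 (of_nat (2 * n + 1)) * L_chi3 (of_nat (k - 2 * n - 1))))"
    unfolding of_real_sum
  proof (intro sum.cong refl)
    fix n
    assume "n \<in> {0..(k - 3) div 2}"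
    then have "k - 2 * n - 1 \<ge> 1" "2 * n + 1 \<ge> 1"
      using assms by auto
    then show "complex_of_real (of_rat (b n) * (L_real (2 * n + 1) * L_real (k - 2 * n - 1))) =
        of_rat (b n) * (L_chi3 (of_nat (2 * n + 1)) * L_chi3 (of_nat (k - 2 * n - 1)))"
      by (simp only: L_chi3_of_nat of_real_mult of_real_of_rat)
  qed
  have "zeta_G2 (of_nat k1) (of_nat k2) (of_nat k3) (of_nat k4) (of_nat k5) (of_nat k6) =
      of_real (infsum (G2_term k1 k2 k3 k4 k5 k6) ({0<..} \<times> {0<..}))"
    by (intro zeta_G2_of_nat assms)
  also have "\<dots> =
      (\<Sum>n = 0..(k - 3) div 2. of_rat (a n) * (zeta (of_nat (2 * n)) * zeta (of_nat (k - 2 * n)))) +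
      (\<Sum>n = 0..(k - 3) div 2.
         of_rat (b n) * (L_chi3 (of_nat (2 * n + 1)) * L_chi3 (of_nat (k - 2 * n - 1))))"
    by (simp only: ab of_real_add zeta_part L_part)
  finally show ?thesis
    by blast
qed

end
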